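(* (i) Nonnegativity: $\mathrm D_{\mathrm{TKL}}(p\|q)\ge0$ for all admissible $p,q$, and $\mathrm D_{\mathrm{TKL}}(p\|q)=0$ if and only if there is $c\in\mathbb R^d$ with $p(x+c)=q(x)$ for all $x\in\mathbb R^d$. (ii) Separability: if $p_1,q_1$ are admissible densities on $\mathbb R^{d_1}$, $p_2,q_2$ admissible densities on $\mathbb R^{d_2}$, and $p(x,y)=p_1(x)p_2(y)$, $q(x,y)=q_1(x)q_2(y)$ on $\mathbb R^{d_1+d_2}$, then $\mathrm D_{\mathrm{TKL}}(p\|q)=\mathrm D_{\mathrm{TKL}}(p_1\|q_1)+\mathrm D_{\mathrm{TKL}}(p_2\|q_2)$. (iii) Hessian metric: for admissible $q$, $\Phi\in C_c^\infty(\mathbb R^d)$ and $q_\epsilon=(\mathrm{id}+\epsilon\nabla\Phi)_\#q$ ($|\epsilon|$ small), as $\epsilon\to0$, $$\mathrm D_{\mathrm{TKL}}(q_\epsilon\|q)=\frac{\epsilon^2}{2}\int_{\mathbb R^d}\mathrm{tr}\big(\nabla^2\Phi(x)\nabla^2\Phi(x)\big)q(x)\,dx+o(\epsilon^2).$$ (iv) Transport convexity: let $q$ be admissible, $p_1=(\nabla\Phi_{p_1})_\#q$, $p_2=(\nabla\Phi_{p_2})_\#q$ with $\nabla\Phi_{p_i}$ the Brenier maps, and for $\lambda\in[0,1]$ let $p_\lambda=(\lambda\nabla\Phi_{p_1}+(1-\lambda)\nabla\Phi_{p_2})_\#q$, assumed admissible. Then $\mathrm D_{\mathrm{TKL}}(p_\lambda\|q)\le\lambda\mathrm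 D_{\mathrm{TKL}}(p_1\|q)+(1-\lambda)\mathrm D_{\mathrm{TKL}}(p_2\|q)$.
   Context: Densities are smooth strictly positive probability densities on $\mathbb R^d$. For such $p,q$, $\nabla\Phi_p$ denotes the Brenier map from $q$ to $p$ (the gradient of a convex function pushing $q$ to $p$, unique $q$-a.e.); the pair is admissible if $\Phi_p\in C^\infty$ with $\nabla^2\Phi_p$ positive definite everywhere, $\nabla\Phi_p$ is a diffeomorphism of $\mathbb R^d$ with $p(\nabla\Phi_p(x))\det\nabla^2\Phi_p(x)=q(x)$, and $q\Delta\Phi_p$, $q\log\det\nabla^2\Phi_p$ are integrable. The transport KL divergence is $\mathrm D_{\mathrm{TKL}}(p\|q)=\int_{\mathbb R^d}\big(\Delta\Phi_p(x)-\log\det\nabla^2\Phi_p(x)-d\big)q(x)\,dx$. *)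

theory Defs
  imports "HOL-Analysis.Analysis" "HOL-Library.Landau_Symbols"
begin

definition partial :: "'n::finite \<Rightarrow> (real^'n \<Rightarrow> real) \<Rightarrow> real^'n \<Rightarrow> real" where
  "partial i f x = deriv (\<lambda>t. f (x + t *\<^sub>R axis i 1)) 0"

definition iter_partial :: "'n::finite list \<Rightarrow> (real^'n \<Rightarrow> real) \<Rightarrow> real^'n \<Rightarrow> real" where
  "iter_partial ks f = foldr partial ks f"

definition smooth :: "(real^'n::finite \<Rightarrow> real) \<Rightarrow> bool" where
  "smooth f \<longleftrightarrow> (\<forall>ks. continuous_on UNIV (iter_partial ks f) \<and>
      (\<forall>i x. (\<lambda>t. iter_partial ks f (x + t *\<^sub>R axis i 1)) differentiable (at 0)))"

definition smooth_map :: "(real^'n::finite \<Rightarrow> real^'n) \<Rightarrow> bool" where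
  "smooth_map F \<longleftrightarrow> (\<forall>i. smooth (\<lambda>x. F x $ i))"

definition diffeo :: "(real^'n::finite \<Rightarrow> real^'n) \<Rightarrow> bool" where
  "diffeo F \<longleftrightarrow> bij F \<and> smooth_map F \<and> smooth_map (inv F)"

definition grad :: "(real^'n::finite \<Rightarrow> real) \<Rightarrow> real^'n \<Rightarrow> real^'n" where
  "grad f x = (\<chi> i. partial i f x)"

definition hess :: "(real^'n::finite \<Rightarrow> real) \<Rightarrow> real^'n \<Rightarrow> real^'n^'n" where
  "hess f x = (\<chi> i j. partial j (partial i f) x)"

definition lap :: "(real^'n::finite \<Rightarrow> real) \<Rightarrow> real^'n \<Rightarrow> real" where
  "lap f x = trace (hess f x)"

definition is_density :: "(real^'n::finite \<Rightarrow> real) \<Rightarrow> bool" where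
  "is_density p \<longleftrightarrow> smooth p \<and> (\<forall>x. p x > 0) \<and> integrable lborel p \<and>
     (LINT x|lborel. p x) = 1"

definition pushes :: "(real^'n::finite \<Rightarrow> real^'n) \<Rightarrow> (real^'n \<Rightarrow> real) \<Rightarrow> (real^'n \<Rightarrow> real) \<Rightarrow> bool" where
  "pushes T q p \<longleftrightarrow> T \<in> borel_measurable lborel \<and>
     distr (density lborel (\<lambda>x. ennreal (q x))) lborel T = density lborel (\<lambda>x. ennreal (p x))"

definition brenier_potential :: "(real^'n::finite \<Rightarrow> real) \<Rightarrow> (real^'n \<Rightarrow> real) \<Rightarrow> (real^'n \<Rightarrow> real) \<Rightarrow> bool" where
  "brenier_potential p q Phi \<longleftrightarrow> convex_on UNIV Phi \<and> pushes (grad Phi) q p"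

definition admissible_pot :: "(real^'n::finite \<Rightarrow> real) \<Rightarrow> (real^'n \<Rightarrow> real) \<Rightarrow> (real^'n \<Rightarrow> real) \<Rightarrow> bool" where
  "admissible_pot p q Phi \<longleftrightarrow> brenier_potential p q Phi \<and> smooth Phi \<and>
     (\<forall>x v. v \<noteq> 0 \<longrightarrow> v \<bullet> (hess Phi x *v v) > 0) \<and>
     diffeo (grad Phi) \<and>
     (\<forall>x. p (grad Phi x) * det (hess Phi x) = q x) \<and>
     integrable lborel (\<lambda>x. q x * lap Phi x) \<and>
     integrable lborel (\<lambda>x. q x * ln (det (hess Phi x)))"

definition admissible :: "(real^'n::finite \<Rightarrow> real) \<Rightarrow> (real^'n \<Rightarrow> real) \<Rightarrow> bool" where
  "admissible p q \<longleftrightarrow> is_density p \<and> is_density q \<and> (\<exists>Phi. admissible_pot p q Phi)"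

text \<open>Transport KL divergence (the value does not depend on the choice of admissible
  potential, since the Brenier map is unique q-a.e. and continuous).\<close>
definition D_TKL :: "(real^'n::finite \<Rightarrow> real) \<Rightarrow> (real^'n \<Rightarrow> real) \<Rightarrow> real" where
  "D_TKL p q = (let Phi = (SOME Phi. admissible_pot p q Phi) in
     LINT x|lborel. (lap Phi x - ln (det (hess Phi x)) - real CARD('n)) * q x)"

definition join :: "real^'n::finite \<Rightarrow> real^'m::finite \<Rightarrow> real^('n + 'm)" where
  "join x y = (\<chi> k. case k of Inl i \<Rightarrow> x $ i | Inr j \<Rightarrow> y $ j)"

end

theory Submission
  imports Defs
begin

text \<open>
  Since the potential is chosen arbitrarily in the divergence, everything rests on uniqueness of the
  transport map. If \<open>grad Phi\<close> and \<open>grad Psi\<close> both push \<open>q\<close> to \<open>p\<close>, then \<open>S = inv (grad Psi) \<circ> grad Phi\<close>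
  preserves \<open>q\<close>, and adding the tangent inequalities of the two convex functions shows
  \<open>(Phi - Psi) \<circ> S \<ge> Phi - Psi\<close>. Integrating \<open>arctan\<close> of both sides against \<open>q\<close> gives equality, and strict
  convexity turns this into \<open>S = id\<close>. The four claims then become statements about the integrand:
  diagonalising the Hessian reduces nonnegativity to \<open>ln t \<le> t - 1\<close>, the second order expansion to the
  Taylor expansion of \<open>ln (1 + t)\<close>, and convexity to concavity of \<open>ln \<circ> det\<close>, while on a product the sum of
  the two potentials is again admissible. For the perturbation \<open>id + e grad Phi\<close> with \<open>Phi\<close> compactly
  supported, the contraction principle gives a global inverse and the Jacobian equation follows from
  the push-forward by change of variables.
\<close>

subsection \<open>Smooth functions\<close>

text \<open>Smoothness is defined by derivatives along coordinate axes only, so Frechet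
  differentiability and symmetry of the Hessian must be derived before any matrix argument applies.
  Symmetry then lets determinants and traces be read off from an orthogonal diagonalisation. In the
  uniqueness argument, nothing is known about the integrability of \<open>Phi - Psi\<close>:
  \<open>arctan\<close> is bounded, which makes both integrals finite, and strictly increasing,
  which preserves the equality case. Measure-theoretic conclusions hold only almost everywhere; they
  become pointwise because densities are strictly positive and the functions compared are
  continuous. For the perturbation, compact support enters through a global bound \<open>K\<close>
  on the Hessian, which makes the expansion uniform in the point and hence integrable against
  \<open>q\<close>. The one threshold \<open>\<bar>e\<bar> * K \<le> 1 / 2\<close> serves three
  times: for the contraction, for positive definiteness, and for the range in which the logarithm is
  expanded.\<close>

lemma iter_partial_Nil [simp]: "iter_partial [] f = f"
  by (simp add: iter_partial_def)

lemma iter_partial_Cons [simp]: "iter_partial (i # ks) f = partial i (iter_partial ks f)"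
  by (simp add: iter_partial_def)

lemma iter_partial_snoc: "iter_partial (ks @ [i]) f = iter_partial ks (partial i f)"
  by (simp add: iter_partial_def)

lemma smooth_partial: "smooth f \<Longrightarrow> smooth (partial i f)"
  unfolding smooth_def iter_partial_snoc [symmetric] by blast

lemma smooth_imp_continuous_on: "smooth f \<Longrightarrow> continuous_on S f"
  unfolding smooth_def by (metis iter_partial_Nil continuous_on_subset subset_UNIV)

lemma smooth_axis_derivative:
  assumes "smooth f"
  shows "((\<lambda>t. f (x + t *\<^sub>R axis i 1)) has_real_derivative partial i f (x + t *\<^sub>R axis i 1)) (at t)"
proof -
  let ?y = "x + t *\<^sub>R axis i 1"
  have "(\<lambda>s. f (?y + s *\<^sub>R axis i 1)) differentiable (at 0)"
    using assms unfolding smooth_def by (metis iter_partial_Nil)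
  then have "((\<lambda>s. f (?y + s *\<^sub>R axis i 1)) has_real_derivative partial i f ?y) (at 0)"
    unfolding partial_def
    using DERIV_deriv_iff_real_differentiable real_differentiable_def by blast
  moreover have "(\<lambda>s. f (?y + s *\<^sub>R axis i 1)) = (\<lambda>s. f (x + (s + t) *\<^sub>R axis i 1))"
    by (simp add: algebra_simps)
  ultimately show ?thesis
    using DERIV_shift[of "\<lambda>s. f (x + s *\<^sub>R axis i 1)" "partial i f ?y" 0 t] by simp
qed

text \<open>The two-sided form is needed because the coordinates of an increment may have either
  sign.\<close>

lemma smooth_axis_mvt:
  assumes "smooth f"
  obtains s where "\<bar>s\<bar> \<le> \<bar>t\<bar>"
    "f (x + t *\<^sub>R axis i 1) - f x = t * partial i f (x + s *\<^sub>R axis i 1)"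
proof -
  let ?g = "\<lambda>s. f (x + s *\<^sub>R axis i 1)"
  note D = smooth_axis_derivative[OF assms, of x i]
  consider "t = 0" | "t > 0" | "t < 0" by linarith
  then show ?thesis
  proof cases
    case 1 then show ?thesis using that[of 0] by simp
  next
    case 2
    from MVT2[OF 2, of ?g "\<lambda>s. partial i f (x + s *\<^sub>R axis i 1)"] D
    obtain z where "0 < z" "z < t" "?g t - ?g 0 = (t - 0) * partial i f (x + z *\<^sub>R axis i 1)" by blast
    then show ?thesis using that[of z] by simp
  next
    case 3
    from MVT2[OF 3, of ?g "\<lambda>s. partial i f (x + s *\<^sub>R axis i 1)"] D
    obtain z where "t < z" "z < 0" "?g 0 - ?g t = (0 - t) * partial i f (x + z *\<^sub>R axis i 1)" by blast
    then show ?thesis using that[of z] by simp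
  qed
qed

lemma inner_grad: "grad f x \<bullet> h = (\<Sum>i\<in>UNIV. h $ i * partial i f x)"
  by (simp add: grad_def inner_vec_def mult.commute)

text \<open>Continuity of the partial derivatives suffices: the increment is travelled one
  coordinate at a time, and on each leg the mean value theorem replaces the difference by a partial
  derivative taken close to \<open>x\<close>.\<close>

theorem smooth_has_derivative:
  fixes f :: "real^'n::finite \<Rightarrow> real"
  assumes "smooth f"
  shows "(f has_derivative (\<lambda>h. grad f x \<bullet> h)) (at x)"
  unfolding has_derivative_at_alt
proof (intro conjI allI impI)
  show "bounded_linear (\<lambda>h. grad f x \<bullet> h)" by (rule bounded_linear_inner_right)
  fix e :: real assume "e > 0"
  let ?N = "real CARD('n)"
  \<comment> \<open>The path along the axes has length at most \<open>?N\<close> times the Euclidean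
    norm of the increment; dividing by \<open>?N\<close> compensates for this.\<close>
  define e' where "e' = e / ?N"
  have "?N > 0" by simp
  then have e': "e' > 0" using \<open>e > 0\<close> by (simp add: e'_def)
  have "\<forall>i. \<exists>\<delta>>0. \<forall>z. dist z x < \<delta> \<longrightarrow> dist (partial i f z) (partial i f x) < e'"
    using smooth_imp_continuous_on[OF smooth_partial[OF assms], of UNIV] e'
    unfolding continuous_on_iff by simp
  then obtain \<delta>i where \<delta>i: "\<And>i. \<delta>i i > 0"
    "\<And>i z. dist z x < \<delta>i i \<Longrightarrow> dist (partial i f z) (partial i f x) < e'" by metis
  define \<delta> where "\<delta> = Min (range \<delta>i)"
  have \<delta>: "\<delta> > 0" "\<And>i z. dist z x < \<delta> \<Longrightarrow> dist (partial i f z) (partial i f x) < e'"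
    using \<delta>i by (auto simp: \<delta>_def)
  \<comment> \<open>Induction on the set of coordinates already moved. The bound on the total length
    keeps all points visited by the path, including the mean value points, within
    \<open>\<delta>\<close> of \<open>x\<close>.\<close>
  have key: "\<bar>f (x + (\<Sum>i\<in>S. c i *\<^sub>R axis i 1)) - f x - (\<Sum>i\<in>S. c i * partial i f x)\<bar> \<le> e' * (\<Sum>i\<in>S. \<bar>c i\<bar>)"
    if "finite S" "(\<Sum>i\<in>S. \<bar>c i\<bar>) < \<delta>" for S c
    using that
  proof (induction S rule: finite_induct)
    case empty then show ?case by simp
  next
    case (insert k S)
    let ?y = "x + (\<Sum>i\<in>S. c i *\<^sub>R axis i 1)"
    obtain s where s: "\<bar>s\<bar> \<le> \<bar>c k\<bar>" "f (?y + c k *\<^sub>R axis k 1) - f ?y = c k * partial k f (?y + s *\<^sub>R axis k 1)"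
      using smooth_axis_mvt[OF assms] by blast
    have "norm (\<Sum>i\<in>S. c i *\<^sub>R axis i 1 :: real^'n) \<le> (\<Sum>i\<in>S. \<bar>c i\<bar>)"
      by (rule order_trans[OF norm_sum]) (simp add: norm_axis_1)
    then have "norm ((\<Sum>i\<in>S. c i *\<^sub>R axis i 1) + s *\<^sub>R axis k 1 :: real^'n) \<le> (\<Sum>i\<in>S. \<bar>c i\<bar>) + \<bar>c k\<bar>"
      using s(1) by (intro norm_triangle_mono) (simp_all add: norm_axis_1)
    then have "dist (?y + s *\<^sub>R axis k 1) x < \<delta>"
      using insert by (simp add: dist_norm algebra_simps)
    from \<delta>(2)[OF this] have "\<bar>partial k f (?y + s *\<^sub>R axis k 1) - partial k f x\<bar> \<le> e'"
      by (simp add: dist_real_def less_imp_le)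
    then have "\<bar>c k * (partial k f (?y + s *\<^sub>R axis k 1) - partial k f x)\<bar> \<le> e' * \<bar>c k\<bar>"
      by (simp add: abs_mult mult.commute[of e'] mult_left_mono)
    moreover have "\<bar>f ?y - f x - (\<Sum>i\<in>S. c i * partial i f x)\<bar> \<le> e' * (\<Sum>i\<in>S. \<bar>c i\<bar>)"
      using insert by auto
    moreover have "x + (\<Sum>i\<in>insert k S. c i *\<^sub>R axis i 1) = ?y + c k *\<^sub>R axis k 1"
      using insert by (simp add: algebra_simps)
    ultimately show ?case using s(2) insert(1,2)
      by (simp add: algebra_simps)
  qed
  show "\<exists>d>0. \<forall>y. norm (y - x) < d \<longrightarrow> norm (f y - f x - grad f x \<bullet> (y - x)) \<le> e * norm (y - x)"
  proof (intro exI conjI allI impI)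
    show "\<delta> / ?N > 0" using \<delta> by simp
    fix y assume y: "norm (y - x) < \<delta> / ?N"
    let ?h = "y - x"
    have 1: "(\<Sum>i\<in>UNIV. \<bar>?h $ i\<bar>) \<le> ?N * norm ?h"
      using sum_bounded_above[of UNIV "\<lambda>i. \<bar>?h $ i\<bar>" "norm ?h"] component_le_norm_cart[of ?h] by auto
    also have "\<dots> < \<delta>" using y by (simp add: field_simps)
    finally have "(\<Sum>i\<in>UNIV. \<bar>?h $ i\<bar>) < \<delta>" .
    from key[OF _ this] have "\<bar>f (x + (\<Sum>i\<in>UNIV. ?h $ i *\<^sub>R axis i 1)) - f x - grad f x \<bullet> ?h\<bar> \<le> e' * (\<Sum>i\<in>UNIV. \<bar>?h $ i\<bar>)"
      by (simp add: inner_grad)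
    moreover have "(\<Sum>i\<in>UNIV. ?h $ i *\<^sub>R axis i 1) = ?h"
      by (simp add: vec_eq_iff axis_def if_distrib sum.delta cong: if_cong)
    moreover have "e' * (\<Sum>i\<in>UNIV. \<bar>?h $ i\<bar>) \<le> e' * (?N * norm ?h)"
      using 1 e' by (simp add: mult_left_mono)
    moreover have "e' * (?N * norm ?h) = e * norm ?h" by (simp add: e'_def)
    ultimately show "norm (f y - f x - grad f x \<bullet> ?h) \<le> e * norm ?h" by simp
  qed
qed

lemma smooth_differentiable: "smooth f \<Longrightarrow> f differentiable (at x)"
  using smooth_has_derivative differentiable_def by blast

lemma partial_eqI:
  fixes f :: "real^'n::finite \<Rightarrow> real"
  assumes "(f has_derivative f') (at x)"
  shows "partial i f x = f' (axis i 1)"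
proof -
  have "((\<lambda>t::real. x + t *\<^sub>R axis i 1) has_derivative (\<lambda>t. t *\<^sub>R axis i 1)) (at 0)"
    by (auto intro!: derivative_eq_intros)
  moreover have "(f has_derivative f') (at (x + 0 *\<^sub>R axis i 1))" using assms by simp
  ultimately have "((\<lambda>t. f (x + t *\<^sub>R axis i 1)) has_derivative (\<lambda>t. f' (t *\<^sub>R axis i 1))) (at 0)"
    by (rule has_derivative_compose)
  moreover have "(\<lambda>t. f' (t *\<^sub>R axis i 1)) = (*) (f' (axis i 1))"
    using has_derivative_linear[OF assms] by (auto simp: linear_cmul mult.commute)
  ultimately show ?thesis
    unfolding partial_def by (intro DERIV_imp_deriv) (simp add: has_field_derivative_def)
qed

text \<open>All iterated partials of \<open>f\<close> stay inside a class closed under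
  \<open>partial\<close>, so only first-order differentiability has to be checked. Sums and
  products, translations, coordinate changes and inverse maps are all handled by choosing a suitable
  class.\<close>

lemma smooth_coinduct:
  fixes f :: "real^'a::finite \<Rightarrow> real"
  assumes "P f" and diff: "\<And>f x. P f \<Longrightarrow> f differentiable (at x)"
    and step: "\<And>f i. P f \<Longrightarrow> P (partial i f)"
  shows "smooth f"
  unfolding smooth_def
proof (intro allI conjI)
  fix ks
  have P: "P (iter_partial ks f)" by (induction ks) (simp_all add: assms)
  show "continuous_on UNIV (iter_partial ks f)"
    using diff[OF P] by (simp add: continuous_on_eq_continuous_at differentiable_imp_continuous_within)
  fix i and x :: "real^'a"
  have "(\<lambda>t::real. x + t *\<^sub>R axis i 1) differentiable (at 0)"
    by (auto intro!: derivative_intros)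
  then have "(iter_partial ks f \<circ> (\<lambda>t. x + t *\<^sub>R axis i 1)) differentiable (at 0)"
    by (rule differentiable_chain_at) (simp add: diff[OF P])
  then show "(\<lambda>t. iter_partial ks f (x + t *\<^sub>R axis i 1)) differentiable (at 0)"
    by (simp add: o_def)
qed

text \<open>The partial derivative of a product is a sum of products, so no single operation yields
  a class closed under \<open>partial\<close>. Closing under all operations at once does, and the
  class turns out to contain nothing but smooth functions.\<close>

inductive smooth_alg :: "(real^'n::finite \<Rightarrow> real) \<Rightarrow> bool" where
  base: "smooth f \<Longrightarrow> smooth_alg f"
| add: "smooth_alg f \<Longrightarrow> smooth_alg g \<Longrightarrow> smooth_alg (\<lambda>x. f x + g x)"
| mult: "smooth_alg f \<Longrightarrow> smooth_alg g \<Longrightarrow> smooth_alg (\<lambda>x. f x * g x)"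
| const: "smooth_alg (\<lambda>x. c)"
| coord: "smooth_alg (\<lambda>x. x $ i)"
| inverse: "smooth_alg f \<Longrightarrow> (\<And>x. f x \<noteq> 0) \<Longrightarrow> smooth_alg (\<lambda>x. inverse (f x))"

lemma smooth_alg_differentiable: "smooth_alg f \<Longrightarrow> f differentiable (at x)"
proof (induction rule: smooth_alg.induct)
  case (coord i)
  show ?case
    by (rule linear_imp_differentiable) (simp add: linear_iff)
qed (auto intro: smooth_differentiable differentiable_add differentiable_mult differentiable_inverse)

lemma partial_add:
  assumes "f differentiable (at x)" "g differentiable (at x)"
  shows "partial i (\<lambda>x. f x + g x) x = partial i f x + partial i g x"
proof -
  obtain f' g' where *: "(f has_derivative f') (at x)" "(g has_derivative g') (at x)"
    using assms unfolding differentiable_def by blast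
  show ?thesis
    by (simp add: partial_eqI[OF *(1)] partial_eqI[OF *(2)] partial_eqI[OF has_derivative_add[OF *]])
qed

lemma partial_mult:
  fixes f :: "real^'n::finite \<Rightarrow> real"
  assumes "f differentiable (at x)" "g differentiable (at x)"
  shows "partial i (\<lambda>x. f x * g x) x = f x * partial i g x + partial i f x * g x"
proof -
  obtain f' g' where *: "(f has_derivative f') (at x)" "(g has_derivative g') (at x)"
    using assms unfolding differentiable_def by blast
  show ?thesis
    by (simp add: partial_eqI[OF *(1)] partial_eqI[OF *(2)] partial_eqI[OF has_derivative_mult[OF *]])
qed

text \<open>The right-hand side uses only products, a constant and a reciprocal, so that it matches
  the generating rules of \<open>smooth_alg\<close>.\<close>

lemma partial_inverse:
  fixes f :: "real^'n::finite \<Rightarrow> real"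
  assumes "f differentiable (at x)" "f x \<noteq> 0"
  shows "partial i (\<lambda>x. inverse (f x)) x = (-1) * (inverse (f x) * partial i f x * inverse (f x))"
proof -
  obtain f' where f': "(f has_derivative f') (at x)" using assms unfolding differentiable_def by blast
  show ?thesis
    by (simp add: partial_eqI[OF f'] partial_eqI[OF Deriv.has_derivative_inverse[OF assms(2) f']])
qed

lemma partial_const: "partial i (\<lambda>x. c) = (\<lambda>x. 0)"
  by (rule ext) (simp add: partial_eqI[OF has_derivative_const])

lemma partial_coord: "partial i (\<lambda>x. x $ j) = (\<lambda>x. if i = j then 1 else 0)"
proof
  fix x :: "real^'a"
  have "((\<lambda>x::real^'a. x $ j) has_derivative (\<lambda>x. x $ j)) (at x)"
    by (rule linear_imp_has_derivative) (simp add: linear_iff)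
  from partial_eqI[OF this] show "partial i (\<lambda>x. x $ j) x = (if i = j then 1 else 0)"
    by (simp add: axis_def)
qed

lemma smooth_alg_partial: "smooth_alg f \<Longrightarrow> smooth_alg (partial i f)"
proof (induction rule: smooth_alg.induct)
  case (base f)
  then show ?case by (intro smooth_alg.base smooth_partial)
next
  case (add f g)
  then have "partial i (\<lambda>x. f x + g x) = (\<lambda>x. partial i f x + partial i g x)"
    by (auto simp: partial_add smooth_alg_differentiable)
  with add show ?case by (auto intro: smooth_alg.intros)
next
  case (mult f g)
  then have "partial i (\<lambda>x. f x * g x) = (\<lambda>x. f x * partial i g x + partial i f x * g x)"
    by (auto simp: partial_mult smooth_alg_differentiable)
  with mult show ?case by (auto intro!: smooth_alg.add smooth_alg.mult)
next
  case (inverse f)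
  then have "partial i (\<lambda>x. inverse (f x)) = (\<lambda>x. (-1) * (inverse (f x) * partial i f x * inverse (f x)))"
    by (auto simp: partial_inverse smooth_alg_differentiable)
  moreover have "smooth_alg \<dots>"
    by (intro smooth_alg.mult smooth_alg.const smooth_alg.inverse inverse)
  ultimately show ?case by metis
qed (simp_all add: partial_const partial_coord smooth_alg.const)

lemma smooth_alg_iff_smooth: "smooth_alg f \<longleftrightarrow> smooth f"
  by (metis smooth_coinduct[of smooth_alg] smooth_alg_differentiable smooth_alg_partial smooth_alg.base)

lemmas smooth_add = smooth_alg.add[unfolded smooth_alg_iff_smooth]
  and smooth_mult = smooth_alg.mult[unfolded smooth_alg_iff_smooth]
  and smooth_const = smooth_alg.const[unfolded smooth_alg_iff_smooth]
  and smooth_coord = smooth_alg.coord[unfolded smooth_alg_iff_smooth]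
  and smooth_inverse = smooth_alg.inverse[unfolded smooth_alg_iff_smooth]

lemma smooth_sum: "finite S \<Longrightarrow> (\<And>i. i \<in> S \<Longrightarrow> smooth (f i)) \<Longrightarrow> smooth (\<lambda>x. \<Sum>i\<in>S. f i x)"
  by (induction S rule: finite_induct) (auto intro: smooth_const smooth_add)

lemma smooth_prod: "finite S \<Longrightarrow> (\<And>i. i \<in> S \<Longrightarrow> smooth (f i)) \<Longrightarrow> smooth (\<lambda>x. \<Prod>i\<in>S. f i x)"
  by (induction S rule: finite_induct) (auto intro: smooth_const smooth_mult)

lemma smooth_det:
  assumes "\<And>i j. smooth (\<lambda>x. A x $ i $ j)"
  shows "smooth (\<lambda>x. det (A x))"
  unfolding det_def by (intro smooth_sum smooth_mult smooth_prod smooth_const assms) auto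

lemma grad_add: "smooth f \<Longrightarrow> smooth g \<Longrightarrow> grad (\<lambda>x. f x + g x) x = grad f x + grad g x"
  by (simp add: grad_def vec_eq_iff partial_add smooth_differentiable)

lemma partial_scale:
  "smooth f \<Longrightarrow> partial i (\<lambda>x. c * f x) = (\<lambda>x. c * partial i f x)"
  by (auto simp: partial_mult smooth_differentiable smooth_const partial_const)

lemma partial_add_smooth:
  "smooth f \<Longrightarrow> smooth g \<Longrightarrow> partial i (\<lambda>x. f x + g x) = (\<lambda>x. partial i f x + partial i g x)"
  by (auto simp: partial_add smooth_differentiable)

lemma grad_scale: "smooth f \<Longrightarrow> grad (\<lambda>x. c * f x) x = c *\<^sub>R grad f x"
  by (simp add: grad_def vec_eq_iff partial_scale)

lemma hess_add: "smooth f \<Longrightarrow> smooth g \<Longrightarrow> hess (\<lambda>x. f x + g x) x = hess f x + hess g x"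
  by (simp add: hess_def vec_eq_iff partial_add_smooth smooth_partial)

lemma hess_scale: "smooth f \<Longrightarrow> hess (\<lambda>x. c * f x) x = c *\<^sub>R hess f x"
  by (simp add: hess_def vec_eq_iff partial_scale smooth_partial)

subsection \<open>Symmetry of the Hessian and convexity\<close>

text \<open>The mean value theorem is applied first to the difference of \<open>f\<close> in
  direction \<open>j\<close>, then to its partial derivative. The left-hand side is symmetric in
  \<open>i\<close> and \<open>j\<close>, which is what later forces the two mixed partials to
  agree.\<close>

lemma smooth_mixed_difference:
  assumes "smooth f"
  obtains s r where "\<bar>s\<bar> \<le> \<bar>t\<bar>" "\<bar>r\<bar> \<le> \<bar>t\<bar>"
    "f (x + t *\<^sub>R axis i 1 + t *\<^sub>R axis j 1) - f (x + t *\<^sub>R axis i 1) - f (x + t *\<^sub>R axis j 1) + f x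
      = t * t * partial j (partial i f) (x + s *\<^sub>R axis i 1 + r *\<^sub>R axis j 1)"
proof -
  let ?d = "t *\<^sub>R axis j 1"
  let ?g = "\<lambda>y. f (y + ?d) + (-1) * f y"
  have shift: "partial k (\<lambda>y. h (y + ?d)) = (\<lambda>y. partial k h (y + ?d))" for k h
    by (rule ext) (simp add: partial_def algebra_simps)
  have "smooth (\<lambda>y. f (y + ?d))"
  proof (rule smooth_coinduct[of "\<lambda>f. \<exists>h. smooth h \<and> f = (\<lambda>y. h (y + ?d))"])
    fix f :: "real^'a \<Rightarrow> real" and x assume "\<exists>h. smooth h \<and> f = (\<lambda>y. h (y + ?d))"
    then obtain h where h: "smooth h" "f = h \<circ> (\<lambda>y. y + ?d)" by (auto simp: o_def)
    show "f differentiable (at x)" unfolding h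
      by (rule differentiable_chain_at) (auto intro: derivative_intros smooth_differentiable h)
  qed (use assms shift smooth_partial in blast)+
  then have g: "smooth ?g" by (intro smooth_add smooth_mult smooth_const assms)
  obtain s where s: "\<bar>s\<bar> \<le> \<bar>t\<bar>" "?g (x + t *\<^sub>R axis i 1) - ?g x = t * partial i ?g (x + s *\<^sub>R axis i 1)"
    using smooth_axis_mvt[OF g] by blast
  obtain r where r: "\<bar>r\<bar> \<le> \<bar>t\<bar>"
    "partial i f (x + s *\<^sub>R axis i 1 + t *\<^sub>R axis j 1) - partial i f (x + s *\<^sub>R axis i 1)
      = t * partial j (partial i f) (x + s *\<^sub>R axis i 1 + r *\<^sub>R axis j 1)"
    using smooth_axis_mvt[OF smooth_partial[OF assms]] by blast
  have pg: "partial i ?g y = partial i f (y + ?d) - partial i f y" for y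
    using partial_add_smooth[OF \<open>smooth (\<lambda>y. f (y + ?d))\<close> smooth_mult[OF smooth_const assms], of i "-1"]
    unfolding shift partial_scale[OF assms] by simp
  have "?g (x + t *\<^sub>R axis i 1) - ?g x = t * (t * partial j (partial i f) (x + s *\<^sub>R axis i 1 + r *\<^sub>R axis j 1))"
    unfolding s(2) pg r(2) ..
  then show ?thesis using that[OF s(1) r(1)] by (simp add: algebra_simps)
qed

theorem smooth_partial_commute:
  assumes "smooth f"
  shows "partial j (partial i f) x = partial i (partial j f) x"
proof (rule ccontr)
  let ?g = "partial j (partial i f)" and ?h = "partial i (partial j f)"
  assume "?g x \<noteq> ?h x"
  \<comment> \<open>Half of the gap: two values that are each closer than this to
    \<open>?g x\<close> and \<open>?h x\<close> respectively cannot coincide.\<close>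
  then have e: "\<bar>?g x - ?h x\<bar> / 2 > 0" (is "?e > 0") by simp
  have "continuous_on UNIV ?g" "continuous_on UNIV ?h"
    using assms by (simp_all add: smooth_imp_continuous_on smooth_partial)
  then obtain d1 d2 where d: "d1 > 0" "d2 > 0"
    "\<And>y. dist y x < d1 \<Longrightarrow> dist (?g y) (?g x) < ?e" "\<And>y. dist y x < d2 \<Longrightarrow> dist (?h y) (?h x) < ?e"
    using e unfolding continuous_on_iff by (metis UNIV_I)
  \<comment> \<open>The mean value points lie at distance at most \<open>2 * t\<close> from
    \<open>x\<close>, so a third of the radius keeps them strictly inside.\<close>
  define t where "t = min d1 d2 / 3"
  have t: "t > 0" using d by (simp add: t_def)
  have near: "dist (x + s *\<^sub>R axis k 1 + r *\<^sub>R axis l 1) x < min d1 d2"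
    if "\<bar>s\<bar> \<le> \<bar>t\<bar>" "\<bar>r\<bar> \<le> \<bar>t\<bar>" for s r k l
  proof -
    have "dist (x + s *\<^sub>R axis k 1 + r *\<^sub>R axis l 1) x = norm (s *\<^sub>R axis k 1 + r *\<^sub>R axis l 1 :: real^'a)"
      by (simp add: dist_norm algebra_simps)
    also have "\<dots> \<le> \<bar>s\<bar> + \<bar>r\<bar>"
      by (rule norm_triangle_le) (simp add: norm_axis_1)
    also have "\<dots> < min d1 d2" using that t unfolding t_def by linarith
    finally show ?thesis .
  qed
  obtain s r where sr: "\<bar>s\<bar> \<le> \<bar>t\<bar>" "\<bar>r\<bar> \<le> \<bar>t\<bar>"
    "f (x + t *\<^sub>R axis i 1 + t *\<^sub>R axis j 1) - f (x + t *\<^sub>R axis i 1) - f (x + t *\<^sub>R axis j 1) + f x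
      = t * t * ?g (x + s *\<^sub>R axis i 1 + r *\<^sub>R axis j 1)"
    using smooth_mixed_difference[OF assms] by blast
  obtain s' r' where sr': "\<bar>s'\<bar> \<le> \<bar>t\<bar>" "\<bar>r'\<bar> \<le> \<bar>t\<bar>"
    "f (x + t *\<^sub>R axis j 1 + t *\<^sub>R axis i 1) - f (x + t *\<^sub>R axis j 1) - f (x + t *\<^sub>R axis i 1) + f x
      = t * t * ?h (x + s' *\<^sub>R axis j 1 + r' *\<^sub>R axis i 1)"
    using smooth_mixed_difference[OF assms] by blast
  have "t * t * ?g (x + s *\<^sub>R axis i 1 + r *\<^sub>R axis j 1) = t * t * ?h (x + s' *\<^sub>R axis j 1 + r' *\<^sub>R axis i 1)"
    using sr(3) sr'(3) by (simp add: algebra_simps)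
  then have "?g (x + s *\<^sub>R axis i 1 + r *\<^sub>R axis j 1) = ?h (x + s' *\<^sub>R axis j 1 + r' *\<^sub>R axis i 1)"
    using t by simp
  then show False
    using d(3)[of "x + s *\<^sub>R axis i 1 + r *\<^sub>R axis j 1"] d(4)[of "x + s' *\<^sub>R axis j 1 + r' *\<^sub>R axis i 1"]
      near[OF sr(1,2), of i j] near[OF sr'(1,2), of j i]
    by (simp add: dist_real_def abs_if split: if_splits)
qed

lemma transpose_hess: "smooth f \<Longrightarrow> transpose (hess f x) = hess f x"
  by (simp add: transpose_def hess_def vec_eq_iff smooth_partial_commute)

lemma hess_component_smooth: "smooth f \<Longrightarrow> smooth (\<lambda>x. hess f x $ i $ j)"
  by (simp add: hess_def smooth_partial)

lemma smooth_lap: "smooth f \<Longrightarrow> smooth (lap f)"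
  unfolding lap_def[abs_def] trace_def by (intro smooth_sum hess_component_smooth) auto

lemma grad_has_derivative:
  assumes "smooth f"
  shows "(grad f has_derivative (\<lambda>h. hess f x *v h)) (at x)"
proof -
  have "((\<lambda>x. grad f x $ i) has_derivative (\<lambda>h. (hess f x *v h) $ i)) (at x)" for i
    using smooth_has_derivative[OF smooth_partial[OF assms, of i], of x]
    by (simp add: grad_def hess_def matrix_vector_mult_def inner_vec_def)
  then show ?thesis
    by (subst has_derivative_componentwise_within) (auto simp: Basis_vec_def inner_axis)
qed

lemma continuous_grad: "smooth f \<Longrightarrow> continuous_on UNIV (grad f)"
  by (meson grad_has_derivative has_derivative_continuous continuous_at_imp_continuous_on)

lemma smooth_line_derivative:
  assumes "smooth f"
  shows "((\<lambda>t. f (x + t *\<^sub>R v)) has_real_derivative grad f (x + t *\<^sub>R v) \<bullet> v) (at t)"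
    and "((\<lambda>t. grad f (x + t *\<^sub>R v) \<bullet> v) has_real_derivative v \<bullet> (hess f (x + t *\<^sub>R v) *v v)) (at t)"
proof -
  have l: "((\<lambda>t. x + t *\<^sub>R v) has_derivative (\<lambda>t. t *\<^sub>R v)) (at t)"
    by (auto intro!: derivative_eq_intros)
  from has_derivative_compose[OF l smooth_has_derivative[OF assms]]
  show "((\<lambda>t. f (x + t *\<^sub>R v)) has_real_derivative grad f (x + t *\<^sub>R v) \<bullet> v) (at t)"
    by (simp add: has_field_derivative_def mult.commute[of _ "_ \<bullet> _"])
  have "((\<lambda>t. grad f (x + t *\<^sub>R v) \<bullet> v) has_derivative (\<lambda>s. (hess f (x + t *\<^sub>R v) *v (s *\<^sub>R v)) \<bullet> v)) (at t)"
    by (rule has_derivative_inner_left[OF has_derivative_compose[OF l grad_has_derivative[OF assms]]])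
  then show "((\<lambda>t. grad f (x + t *\<^sub>R v) \<bullet> v) has_real_derivative v \<bullet> (hess f (x + t *\<^sub>R v) *v v)) (at t)"
    by (simp add: has_field_derivative_def matrix_vector_mult_scaleR inner_commute mult.commute[of _ "_ \<bullet> _"])
qed

lemma convex_on_UNIV_if_hess:
  assumes "smooth f" "\<And>x v. v \<bullet> (hess f x *v v) \<ge> 0"
  shows "convex_on UNIV f"
proof (rule convex_onI)
  fix t :: real and x y assume t: "0 < t" "t < 1"
  have "convex_on UNIV (\<lambda>t. f (x + t *\<^sub>R (y - x)))"
    by (rule f''_ge0_imp_convex) (auto intro: smooth_line_derivative[OF assms(1)] assms(2))
  from convex_onD[OF this, of t 0 1] t
  show "f ((1 - t) *\<^sub>R x + t *\<^sub>R y) \<le> (1 - t) * f x + t * f y"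
    by (simp add: algebra_simps)
qed simp

text \<open>Two uses of the mean value theorem on the segment: the increment is the slope at an
  interior point, and that slope exceeds the initial one by a positive second derivative.\<close>

lemma strict_tangent_inequality:
  assumes "smooth f" and pos: "\<And>x v. v \<noteq> 0 \<Longrightarrow> v \<bullet> (hess f x *v v) > 0" and "x \<noteq> y"
  shows "f y > f x + grad f x \<bullet> (y - x)"
proof -
  let ?v = "y - x"
  let ?g = "\<lambda>t. f (x + t *\<^sub>R ?v)" and ?g' = "\<lambda>t. grad f (x + t *\<^sub>R ?v) \<bullet> ?v"
  obtain z where z: "0 < z" "z < 1" "?g 1 - ?g 0 = (1 - 0) * ?g' z"
    using MVT2[of 0 1 ?g ?g'] smooth_line_derivative(1)[OF assms(1)] by auto
  obtain w where w: "?g' z - ?g' 0 = (z - 0) * (?v \<bullet> (hess f (x + w *\<^sub>R ?v) *v ?v))"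
    using MVT2[of 0 z ?g' "\<lambda>w. ?v \<bullet> (hess f (x + w *\<^sub>R ?v) *v ?v)"] z(1) smooth_line_derivative(2)[OF assms(1)] by blast
  have "?v \<bullet> (hess f (x + w *\<^sub>R ?v) *v ?v) > 0" using pos \<open>x \<noteq> y\<close> by simp
  with w z(1) have "?g' z > ?g' 0" by (metis diff_gt_0_iff_gt diff_zero mult_pos_pos)
  with z(3) show ?thesis by simp
qed

subsection \<open>Symmetric matrices\<close>

text \<open>The residual \<open>w = f x - M *\<^sub>R x\<close> is orthogonal to \<open>x\<close>.
  If it were nonzero, moving from \<open>x\<close> in direction \<open>w\<close> would raise the
  Rayleigh quotient to first order, against maximality.\<close>

lemma self_adjoint_maximizer_eigenvector:
  fixes f :: "'a::euclidean_space \<Rightarrow> 'a"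
  assumes f: "linear f" and sa: "\<And>x y. f x \<bullet> y = x \<bullet> f y"
    and V: "subspace V" "f ` V \<subseteq> V" and x: "x \<in> V" "norm x = 1"
    and max: "\<And>y. y \<in> V \<Longrightarrow> norm y = 1 \<Longrightarrow> y \<bullet> f y \<le> x \<bullet> f x"
  shows "f x = (x \<bullet> f x) *\<^sub>R x"
proof -
  define M where "M = x \<bullet> f x"
  have xx: "x \<bullet> x = 1" using x(2) by (simp add: dot_square_norm)
  have quad: "y \<bullet> f y \<le> M * (y \<bullet> y)" if "y \<in> V" for y
  proof (cases "y = 0")
    case True then show ?thesis using f by (simp add: linear_0)
  next
    case False
    define u where "u = (1 / norm y) *\<^sub>R y"
    have "u \<bullet> f u \<le> M" unfolding M_def
      using V(1) that False by (intro max) (auto simp: u_def subspace_scale)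
    moreover have "u \<bullet> f u = (y \<bullet> f y) / (y \<bullet> y)"
      using f by (simp add: u_def linear_cmul dot_square_norm power2_eq_square)
    ultimately show ?thesis using False by (simp add: field_simps)
  qed
  define w where "w = f x - M *\<^sub>R x"
  have w: "w \<in> V" "x \<bullet> w = 0"
    using V x(1) xx by (auto simp: w_def M_def subspace_diff subspace_scale inner_diff_right)
  have fxw: "f x \<bullet> w = w \<bullet> w"
    using w(2) by (simp add: w_def inner_diff_left)
  define C where "C = M * (w \<bullet> w) - w \<bullet> f w"
  \<comment> \<open>The quadratic bound at \<open>x + t *\<^sub>R w\<close>: the gain is linear in
    \<open>t\<close>, the available slack only quadratic.\<close>
  have le: "2 * t * (w \<bullet> w) \<le> t\<^sup>2 * C" for t
  proof -
    have "x + t *\<^sub>R w \<in> V" using V x w by (simp add: subspace_add subspace_scale)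
    from quad[OF this] have "M + t * (x \<bullet> f w) + t * (w \<bullet> f x) + t\<^sup>2 * (w \<bullet> f w) \<le> M * (1 + t\<^sup>2 * (w \<bullet> w))"
      using f w(2) xx
      by (simp add: linear_add linear_cmul inner_add_left inner_add_right M_def inner_commute[of w x]
          power2_eq_square algebra_simps)
    moreover have "x \<bullet> f w = w \<bullet> w" "w \<bullet> f x = w \<bullet> w"
      using fxw sa[of x w] by (simp_all add: inner_commute)
    ultimately show ?thesis by (simp add: C_def algebra_simps)
  qed
  have "w \<bullet> w = 0"
  proof (rule ccontr)
    assume "w \<bullet> w \<noteq> 0"
    then have pos: "w \<bullet> w > 0" by simp
    \<comment> \<open>Chosen so that \<open>t * C \<le> w \<bullet> w\<close>, which contradicts the
      factor 2 in \<open>le\<close>; the summand 1 avoids division by zero.\<close>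
    define t where "t = (w \<bullet> w) / (\<bar>C\<bar> + 1)"
    have t: "t > 0" using pos by (simp add: t_def)
    have "t * C \<le> t * (\<bar>C\<bar> + 1)" using t by (simp add: mult_left_mono)
    also have "\<dots> = w \<bullet> w" by (simp add: t_def)
    finally have "t * (t * C) \<le> t * (w \<bullet> w)" using t by (simp add: mult_left_mono)
    with le[of t] have "t * (w \<bullet> w) \<le> 0" by (simp add: power2_eq_square algebra_simps)
    with mult_pos_pos[OF t pos] show False by linarith
  qed
  then show ?thesis by (simp add: w_def M_def)
qed

text \<open>Compactness of the unit sphere of \<open>V\<close> supplies a maximiser of the Rayleigh
  quotient. By self-adjointness its orthogonal complement in \<open>V\<close> is again invariant and
  of smaller dimension, so induction applies.\<close>

lemma self_adjoint_eigenbasis: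
  fixes f :: "'a::euclidean_space \<Rightarrow> 'a"
  assumes f: "linear f" and sa: "\<And>x y. f x \<bullet> y = x \<bullet> f y"
    and V: "subspace V" "f ` V \<subseteq> V"
  shows "\<exists>B\<subseteq>V. pairwise orthogonal B \<and> (\<forall>b\<in>B. norm b = 1 \<and> (\<exists>c. f b = c *\<^sub>R b)) \<and> span B = V"
  using V
proof (induction "dim V" arbitrary: V rule: less_induct)
  case less
  show ?case
  proof (cases "V = {0}")
    case True
    then show ?thesis by (intro exI[of _ "{}"]) auto
  next
    case False
    have "0 \<in> V" using less.prems by (simp add: subspace_0)
    with False obtain v where v: "v \<in> V" "v \<noteq> 0" by blast
    let ?K = "V \<inter> sphere 0 1"
    have "compact ?K" using closed_subspace[OF less.prems(1)] by (simp add: closed_Int_compact)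
    moreover have "(1 / norm v) *\<^sub>R v \<in> ?K" using v less.prems by (simp add: subspace_scale)
    then have "?K \<noteq> {}" by blast
    moreover have "continuous_on ?K (\<lambda>x. x \<bullet> f x)"
      using f by (intro continuous_intros linear_continuous_on) (simp add: linear_conv_bounded_linear)
    ultimately obtain x where x: "x \<in> ?K" "\<And>y. y \<in> ?K \<Longrightarrow> y \<bullet> f y \<le> x \<bullet> f x"
      using continuous_attains_sup by metis
    have ev: "f x = (x \<bullet> f x) *\<^sub>R x"
      by (rule self_adjoint_maximizer_eigenvector[OF f sa less.prems]) (use x in auto)
    have xx: "x \<bullet> x = 1" "x \<in> V" using x(1) by (auto simp: dot_square_norm)
    define W where "W = V \<inter> {w. x \<bullet> w = 0}"
    have W: "subspace W" unfolding W_def by (intro subspace_inter less.prems subspace_hyperplane)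
    have fW: "f ` W \<subseteq> W"
    proof
      fix z assume "z \<in> f ` W"
      then obtain w where w: "w \<in> V" "x \<bullet> w = 0" "z = f w" by (auto simp: W_def)
      have "x \<bullet> f w = f x \<bullet> w" using sa by simp
      also have "\<dots> = 0" using ev w by (metis inner_scaleR_left mult_zero_right)
      finally show "z \<in> W" using w less.prems by (auto simp: W_def)
    qed
    have "x \<notin> W" using xx by (simp add: W_def)
    then have "W \<noteq> V" using xx by blast
    then have "dim W < dim V"
      using W less.prems subspace_dim_equal[of W V] by (metis W_def Int_lower1 linorder_not_less)
    from less.hyps[OF this W fW] obtain B where B: "B \<subseteq> W" "pairwise orthogonal B"
      "\<forall>b\<in>B. norm b = 1 \<and> (\<exists>c. f b = c *\<^sub>R b)" "span B = W" by blast
    have "span (insert x B) = V"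
    proof
      show "span (insert x B) \<subseteq> V"
        using B(1) xx less.prems by (intro span_minimal) (auto simp: W_def)
      show "V \<subseteq> span (insert x B)"
      proof
        fix u assume u: "u \<in> V"
        have "u - (x \<bullet> u) *\<^sub>R x \<in> span B"
          using u xx less.prems by (simp add: B(4) W_def subspace_diff subspace_scale inner_diff_right)
        then show "u \<in> span (insert x B)" using span_breakdown_eq by metis
      qed
    qed
    moreover have "pairwise orthogonal (insert x B)"
      using B(1,2) by (auto simp: pairwise_insert orthogonal_def W_def inner_commute)
    ultimately show ?thesis
      using B x(1) ev xx by (intro exI[of _ "insert x B"]) (auto simp: W_def)
  qed
qed

definition diag :: "('n::finite \<Rightarrow> real) \<Rightarrow> real^'n^'n" where
  "diag d = (\<chi> i j. if i = j then d i else 0)"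

lemma diag_mult: "diag d ** diag e = diag (\<lambda>i. d i * e i)"
proof -
  have "(if i = k then d i else 0) * (if k = j then e k else 0)
      = (if k = i then if i = j then d i * e i else 0 else 0)" for i j k by simp
  then show ?thesis by (simp add: diag_def matrix_matrix_mult_def vec_eq_iff)
qed

lemma det_diag: "det (diag d) = (\<Prod>i\<in>UNIV. d i)"
  by (subst det_diagonal) (auto simp: diag_def)

lemma trace_diag: "trace (diag d) = (\<Sum>i\<in>UNIV. d i)"
  by (simp add: trace_def diag_def)

lemma transpose_diag [simp]: "transpose (diag d) = diag d"
  by (auto simp: transpose_def diag_def vec_eq_iff)

text \<open>The clauses on the columns are kept because bounds on the eigenvalues are obtained by
  testing the matrix on unit eigenvectors.\<close>

theorem symmetric_matrix_diagonalization:
  fixes A :: "real^'n::finite^'n"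
  assumes "transpose A = A"
  obtains Q d where "orthogonal_matrix Q" "A = Q ** diag d ** transpose Q"
    "\<And>i. A *v column i Q = d i *\<^sub>R column i Q" "\<And>i. norm (column i Q) = 1"
proof -
  have "\<exists>B\<subseteq>UNIV. pairwise orthogonal B \<and> (\<forall>b\<in>B. norm b = 1 \<and> (\<exists>c. A *v b = c *\<^sub>R b)) \<and> span B = (UNIV :: (real^'n) set)"
    by (rule self_adjoint_eigenbasis) (auto simp: dot_lmul_matrix[symmetric] assms vector_transpose_matrix
        simp flip: transpose_matrix_vector)
  then obtain B where B: "pairwise orthogonal B" "\<And>b. b \<in> B \<Longrightarrow> norm b = 1"
    "\<And>b. b \<in> B \<Longrightarrow> \<exists>c. A *v b = c *\<^sub>R b" "span B = (UNIV :: (real^'n) set)" by blast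
  have "0 \<notin> B" using B(2) by force
  then have ind: "independent B" using B(1) pairwise_orthogonal_independent by blast
  \<comment> \<open>An independent spanning set has as many elements as there are coordinates, so it
    can be indexed by the coordinate type and used as the columns of \<open>Q\<close>.\<close>
  then have "card B = CARD('n)" "finite B"
    using B(4) dim_eq_card_independent[OF ind] dim_span[of B] by (simp_all add: independent_imp_finite)
  then obtain b where b: "bij_betw b (UNIV :: 'n set) B"
    using finite_same_card_bij[of "UNIV :: 'n set" B] by auto
  define Q :: "real^'n^'n" where "Q = (\<chi> i j. b j $ i)"
  have col: "column j Q = b j" for j by (simp add: Q_def column_def vec_eq_iff)
  have bB: "b j \<in> B" for j using b by (auto simp: bij_betw_def)
  have "b i \<noteq> b j" if "i \<noteq> j" for i j
    using bij_betw_imp_inj_on[OF b] that by (auto dest: injD)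
  then have "orthogonal (b i) (b j)" if "i \<noteq> j" for i j
    using pairwiseD[OF B(1) bB bB] that by blast
  then have orth: "orthogonal_matrix Q"
    unfolding orthogonal_matrix_orthonormal_columns col using B(2)[OF bB] by simp
  have "\<forall>j. \<exists>c. A *v b j = c *\<^sub>R b j" using B(3)[OF bB] by (rule allI)
  from choice[OF this] obtain d where d: "\<And>j. A *v b j = d j *\<^sub>R b j" by blast
  have "(A ** Q) $ i $ j = (Q ** diag d) $ i $ j" for i j
  proof -
    have "(A ** Q) $ i $ j = (A *v b j) $ i"
      unfolding matrix_matrix_mult_def matrix_vector_mult_def Q_def by simp
    also have "\<dots> = (Q ** diag d) $ i $ j"
      by (simp add: d matrix_matrix_mult_def Q_def diag_def if_distrib sum.delta cong: if_cong)
    finally show ?thesis .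
  qed
  then have "A ** Q = Q ** diag d" by (simp add: vec_eq_iff)
  then have "A = Q ** diag d ** transpose Q"
  proof -
    assume *: "A ** Q = Q ** diag d"
    have "A = A ** (Q ** transpose Q)" using orth by (simp add: orthogonal_matrix_def)
    also have "\<dots> = (A ** Q) ** transpose Q" by (simp only: matrix_mul_assoc)
    finally show ?thesis unfolding * .
  qed
  then show ?thesis using that[OF orth _ _ _, of d] d B(2)[OF bB] by (simp add: col)
qed

lemma det_conj:
  fixes Q :: "real^'n::finite^'n"
  assumes "orthogonal_matrix Q"
  shows "det (Q ** D ** transpose Q) = det D"
  using det_orthogonal_matrix[OF assms] by (auto simp: det_mul)

lemma trace_conj:
  fixes Q :: "real^'n::finite^'n"
  assumes "orthogonal_matrix Q"
  shows "trace (Q ** D ** transpose Q) = trace D"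
proof -
  have "trace (Q ** D ** transpose Q) = trace (transpose Q ** (Q ** D))" by (rule trace_mul_sym)
  also have "\<dots> = trace ((transpose Q ** Q) ** D)" by (simp only: matrix_mul_assoc)
  finally show ?thesis using assms by (simp add: orthogonal_matrix_def)
qed

lemma conj_mult:
  fixes Q :: "real^'n::finite^'n"
  assumes "orthogonal_matrix Q"
  shows "(Q ** D ** transpose Q) ** (Q ** E ** transpose Q) = Q ** (D ** E) ** transpose Q"
proof -
  have "(Q ** D ** transpose Q) ** (Q ** E ** transpose Q) = Q ** D ** (transpose Q ** Q) ** E ** transpose Q"
    by (simp only: matrix_mul_assoc)
  also have "\<dots> = Q ** D ** E ** transpose Q" using assms by (simp add: orthogonal_matrix_def)
  finally show ?thesis by (simp only: matrix_mul_assoc)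
qed

section \<open>Positive definite matrices and the logarithm of the determinant\<close>

definition posdef :: "real^'n::finite^'n \<Rightarrow> bool" where
  "posdef A \<longleftrightarrow> transpose A = A \<and> (\<forall>v. v \<noteq> 0 \<longrightarrow> v \<bullet> (A *v v) > 0)"

lemma posdef_diagonalization:
  assumes "posdef A"
  obtains Q d where "orthogonal_matrix Q" "A = Q ** diag d ** transpose Q" "\<And>i. d i > 0"
proof -
  obtain Q d where Q: "orthogonal_matrix Q" "A = Q ** diag d ** transpose Q"
    "\<And>i. A *v column i Q = d i *\<^sub>R column i Q" "\<And>i. norm (column i Q) = 1"
    using symmetric_matrix_diagonalization assms unfolding posdef_def by metis
  have "d i > 0" for i
  proof -
    have "column i Q \<noteq> 0" using Q(4)[of i] by force
    with assms have "column i Q \<bullet> (A *v column i Q) > 0" unfolding posdef_def by blast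
    then show ?thesis using Q(3,4) by (simp add: dot_square_norm)
  qed
  with that Q show ?thesis by blast
qed

lemma posdef_det_pos: "posdef A \<Longrightarrow> det A > 0"
  by (erule posdef_diagonalization) (simp add: det_conj det_diag prod_pos)

text \<open>In terms of eigenvalues the expression is a sum of nonnegative terms, so it can vanish
  only if each term does. This forces every eigenvalue to be 1, and a diagonalisable matrix with
  that spectrum is the identity.\<close>

lemma trace_ln_det_inequality:
  fixes A :: "real^'n::finite^'n"
  assumes "posdef A"
  shows "trace A - ln (det A) - real CARD('n) \<ge> 0"
    and "trace A - ln (det A) - real CARD('n) = 0 \<Longrightarrow> A = mat 1"
proof -
  obtain Q d where Q: "orthogonal_matrix Q" "A = Q ** diag d ** transpose Q" "\<And>i. d i > 0"
    using posdef_diagonalization[OF assms] by blast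
  have eq: "trace A - ln (det A) - real CARD('n) = (\<Sum>i\<in>UNIV. d i - 1 - ln (d i))"
    using Q by (simp add: det_conj trace_conj det_diag trace_diag ln_prod sum_subtractf less_imp_neq[symmetric])
  have nn: "d i - 1 - ln (d i) \<ge> 0" for i using ln_le_minus_one[OF Q(3)[of i]] by simp
  show "trace A - ln (det A) - real CARD('n) \<ge> 0" unfolding eq by (intro sum_nonneg nn)
  assume "trace A - ln (det A) - real CARD('n) = 0"
  then have "\<forall>i. d i - 1 - ln (d i) = 0"
    unfolding eq using nn by (subst (asm) sum_nonneg_eq_0_iff) auto
  then have "d i = 1" for i using ln_eq_minus_one[OF Q(3)[of i]] by (simp add: algebra_simps)
  then have "diag d = mat 1" by (simp add: diag_def mat_def vec_eq_iff)
  then show "A = mat 1" using Q(1) by (simp add: Q(2) orthogonal_matrix_def)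
qed

lemma posdef_congruence:
  fixes A M :: "real^'n::finite^'n"
  assumes "posdef A" "invertible M"
  shows "posdef (M ** A ** transpose M)"
  unfolding posdef_def
proof (intro conjI allI impI)
  show "transpose (M ** A ** transpose M) = M ** A ** transpose M"
    using assms(1) by (simp add: posdef_def matrix_transpose_mul transpose_transpose matrix_mul_assoc)
  fix v :: "real^'n" assume "v \<noteq> 0"
  have "transpose M *v v \<noteq> 0"
    using \<open>v \<noteq> 0\<close> assms(2) by (metis invertible_def matrix_left_invertible_ker transpose_invertible)
  then have "(transpose M *v v) \<bullet> (A *v (transpose M *v v)) > 0" using assms(1) by (simp add: posdef_def)
  then show "v \<bullet> ((M ** A ** transpose M) *v v) > 0"
    by (simp add: dot_lmul_matrix[symmetric] matrix_vector_mul_assoc[symmetric] transpose_matrix_vector vector_transpose_matrix)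
qed

text \<open>The supporting hyperplane of \<open>ln \<circ> det\<close> at \<open>A\<close>, with
  \<open>T\<close> the inverse of \<open>A\<close>. A congruence turning \<open>A\<close> into the
  identity reduces it to \<open>trace_ln_det_inequality\<close>.\<close>

lemma ln_det_tangent:
  fixes A B :: "real^'n::finite^'n"
  assumes A: "posdef A"
  obtains T where "\<And>B. posdef B \<Longrightarrow> ln (det B) \<le> ln (det A) + trace (T ** B) - real CARD('n)" "T ** A = mat 1"
proof -
  obtain Q d where Q: "orthogonal_matrix Q" "A = Q ** diag d ** transpose Q" "\<And>i. d i > 0"
    using posdef_diagonalization[OF A] by blast
  \<comment> \<open>An inverse square root of \<open>A\<close> up to a rotation:
    \<open>R ** A ** transpose R = mat 1\<close>, so \<open>transpose R ** R\<close> is the inverse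
    of \<open>A\<close>.\<close>
  define R where "R = diag (\<lambda>i. 1 / sqrt (d i)) ** transpose Q"
  define T where "T = transpose R ** R"
  have RA: "R ** A ** transpose R = mat 1"
  proof -
    have QQ: "transpose Q ** Q = mat 1" using Q(1) by (simp add: orthogonal_matrix_def)
    have "R ** A ** transpose R = diag (\<lambda>i. 1 / sqrt (d i)) ** (transpose Q ** Q) ** diag d ** (transpose Q ** Q) ** diag (\<lambda>i. 1 / sqrt (d i))"
      by (simp add: R_def Q(2) matrix_transpose_mul transpose_transpose matrix_mul_assoc)
    also have "\<dots> = diag (\<lambda>i. 1 / sqrt (d i) * d i * (1 / sqrt (d i)))"
      by (simp add: QQ diag_mult)
    also have "\<dots> = mat 1"
      using Q(3) by (auto simp: diag_def mat_def vec_eq_iff less_imp_neq[symmetric] abs_of_pos)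
    finally show ?thesis .
  qed
  have inv: "invertible R"
    using RA unfolding invertible_right_inverse matrix_mul_assoc[symmetric] by blast
  have "T ** A = mat 1"
  proof -
    have "transpose R ** (R ** A) = mat 1"
      using RA by (simp add: matrix_left_right_inverse)
    then show ?thesis by (simp add: T_def matrix_mul_assoc)
  qed
  moreover have "ln (det B) \<le> ln (det A) + trace (T ** B) - real CARD('n)" if B: "posdef B" for B
  proof -
    let ?C = "R ** B ** transpose R"
    have "posdef ?C" by (rule posdef_congruence[OF B inv])
    from trace_ln_det_inequality(1)[OF this] have "ln (det ?C) \<le> trace ?C - real CARD('n)" by simp
    moreover have "trace ?C = trace (T ** B)"
      unfolding T_def by (subst trace_mul_sym) (simp only: matrix_mul_assoc)
    moreover have "det R * det R * det A = 1"
      using arg_cong[OF RA, of det] by (simp add: det_mul mult_ac)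
    then have "ln (det ?C) = ln (det B) - ln (det A)"
    proof -
      assume r: "det R * det R * det A = 1"
      have p: "det A > 0" "det B > 0" using A B by (simp_all add: posdef_det_pos)
      have "det ?C = (det R * det R) * det B" by (simp add: det_mul mult_ac)
      also have "\<dots> = det B / det A" using r p by (simp add: field_simps)
      finally show ?thesis using p by (simp add: ln_div)
    qed
    ultimately show ?thesis by simp
  qed
  ultimately show ?thesis using that by blast
qed

lemma posdef_convex_combination:
  assumes "posdef A" "posdef B" "0 \<le> l" "l \<le> 1"
  shows "posdef (l *\<^sub>R A + (1 - l) *\<^sub>R B)"
proof -
  have "transpose (l *\<^sub>R A + (1 - l) *\<^sub>R B) = l *\<^sub>R transpose A + (1 - l) *\<^sub>R transpose B"
    by (simp add: transpose_def vec_eq_iff)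
  moreover have "v \<bullet> ((l *\<^sub>R A + (1 - l) *\<^sub>R B) *v v) > 0" if "v \<noteq> 0" for v
  proof -
    have "v \<bullet> (A *v v) > 0" "v \<bullet> (B *v v) > 0" using assms that by (simp_all add: posdef_def)
    \<comment> \<open>At least one weight is positive: for \<open>l = 0\<close> only
      \<open>B\<close> remains, otherwise the term of \<open>A\<close> is already positive.\<close>
    then have "l * (v \<bullet> (A *v v)) + (1 - l) * (v \<bullet> (B *v v)) > 0"
      using assms(3,4) by (cases "l = 0") (auto intro!: add_pos_nonneg)
    then show ?thesis
      by (simp add: matrix_vector_mult_add_rdistrib scaleR_matrix_vector_assoc[symmetric] inner_add_right)
  qed
  ultimately show ?thesis using assms by (simp add: posdef_def)
qed

lemma matrix_mult_scaleR:
  fixes A :: "real^'m::finite^'n::finite" and B :: "real^'k::finite^'m"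
  shows "A ** (c *\<^sub>R B) = c *\<^sub>R (A ** B)" "(c *\<^sub>R A) ** B = c *\<^sub>R (A ** B)"
  by (simp_all add: matrix_matrix_mult_def vec_eq_iff sum_distrib_left mult_ac)

lemma matrix_add_rdistrib:
  fixes A B :: "real^'m::finite^'n::finite" and C :: "real^'k::finite^'m"
  shows "(A + B) ** C = A ** C + B ** C"
  by (simp add: matrix_matrix_mult_def vec_eq_iff sum.distrib distrib_right)

lemma trace_scaleR: "trace (c *\<^sub>R A) = c * trace (A :: real^'n::finite^'n)"
  by (simp add: trace_def sum_distrib_left)

text \<open>The tangent at the combination \<open>?C\<close> bounds the values at both
  \<open>A\<close> and \<open>B\<close>. In the weighted average the linear terms add up to
  \<open>trace (T ** ?C)\<close>, which is the dimension and cancels.\<close>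

theorem ln_det_concave:
  fixes A B :: "real^'n::finite^'n"
  assumes "posdef A" "posdef B" "0 \<le> l" "l \<le> 1"
  shows "l * ln (det A) + (1 - l) * ln (det B) \<le> ln (det (l *\<^sub>R A + (1 - l) *\<^sub>R B))"
proof -
  let ?C = "l *\<^sub>R A + (1 - l) *\<^sub>R B"
  obtain T where T: "\<And>B. posdef B \<Longrightarrow> ln (det B) \<le> ln (det ?C) + trace (T ** B) - real CARD('n)" "T ** ?C = mat 1"
    using ln_det_tangent[OF posdef_convex_combination[OF assms]] by blast
  have "trace (T ** ?C) = l * trace (T ** A) + (1 - l) * trace (T ** B)"
    by (simp add: matrix_add_ldistrib trace_add trace_scaleR matrix_mult_scaleR)
  then have n: "l * trace (T ** A) + (1 - l) * trace (T ** B) = real CARD('n)"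
    using T(2) by (simp add: trace_I)
  have "l * ln (det A) + (1 - l) * ln (det B)
      \<le> l * (ln (det ?C) + trace (T ** A) - real CARD('n)) + (1 - l) * (ln (det ?C) + trace (T ** B) - real CARD('n))"
    using T(1)[OF assms(1)] T(1)[OF assms(2)] assms(3,4) by (intro add_mono mult_left_mono) auto
  also have "\<dots> = ln (det ?C) + (l * trace (T ** A) + (1 - l) * trace (T ** B)) - real CARD('n)"
    by (simp add: algebra_simps)
  finally show ?thesis using n by simp
qed

text \<open>The error vanishes at 0 and has derivative \<open>- (z\<^sup>2 / (1 + z))\<close>. On
  the interval considered \<open>1 / (1 + z) \<le> 2\<close>, which is the origin of the constant
  2.\<close>

lemma ln_one_plus_cubic_bound:
  fixes x :: real
  assumes "\<bar>x\<bar> \<le> 1 / 2"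
  shows "\<bar>x - ln (1 + x) - x\<^sup>2 / 2\<bar> \<le> 2 * \<bar>x\<bar> ^ 3"
proof -
  let ?h = "\<lambda>x. x - ln (1 + x) - x\<^sup>2 / 2" and ?h' = "\<lambda>x. - (x\<^sup>2 / (1 + x))"
  have D: "(?h has_real_derivative ?h' z) (at z)" if "\<bar>z\<bar> \<le> 1 / 2" for z :: real
    using that by (auto intro!: derivative_eq_intros simp: field_simps power2_eq_square)
  have "\<exists>z. \<bar>z\<bar> \<le> \<bar>x\<bar> \<and> ?h x = x * ?h' z"
  proof -
    consider "x = 0" | "x > 0" | "x < 0" by linarith
    then show ?thesis
    proof cases
      case 1 then show ?thesis by auto
    next
      case 2
      from MVT2[OF 2, of ?h ?h'] D assms obtain z where "0 < z" "z < x" "?h x - ?h 0 = (x - 0) * ?h' z"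
        by force
      then show ?thesis by (intro exI[of _ z]) auto
    next
      case 3
      from MVT2[OF 3, of ?h ?h'] D assms obtain z where "x < z" "z < 0" "?h 0 - ?h x = (0 - x) * ?h' z"
        by force
      then show ?thesis by (intro exI[of _ z]) auto
    qed
  qed
  then obtain z where z: "\<bar>z\<bar> \<le> \<bar>x\<bar>" "?h x = x * ?h' z" by blast
  have "1 / (1 + z) \<le> 2" "1 + z > 0" using z(1) assms by (auto simp: field_simps)
  then have "\<bar>?h' z\<bar> \<le> z\<^sup>2 * 2"
    using mult_left_mono[of "1 / (1 + z)" 2 "z\<^sup>2"] by simp
  also have "\<dots> \<le> 2 * \<bar>x\<bar>\<^sup>2" using z(1) by (simp add: abs_le_square_iff)
  finally have "\<bar>x\<bar> * \<bar>?h' z\<bar> \<le> \<bar>x\<bar> * (2 * \<bar>x\<bar>\<^sup>2)" by (intro mult_left_mono) auto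
  then have "\<bar>?h x\<bar> \<le> \<bar>x\<bar> * (2 * \<bar>x\<bar>\<^sup>2)" unfolding z(2) abs_mult .
  also have "\<dots> = 2 * \<bar>x\<bar> ^ 3" by (simp add: power3_eq_cube power2_eq_square)
  finally show ?thesis .
qed

text \<open>\<open>K\<close> bounds the operator norm, hence each eigenvalue. The condition on
  \<open>e\<close> therefore keeps every \<open>e * d i\<close> in the range of the scalar
  expansion, and summing over the eigenvalues produces the factor \<open>CARD('n)\<close>.\<close>

lemma symmetric_perturbation:
  fixes H :: "real^'n::finite^'n"
  assumes sym: "transpose H = H" and K: "\<And>v. norm (H *v v) \<le> K * norm v" and e: "\<bar>e\<bar> * K \<le> 1 / 2"
  shows "posdef (mat 1 + e *\<^sub>R H)"
    and "\<bar>e * trace H - ln (det (mat 1 + e *\<^sub>R H)) - e\<^sup>2 / 2 * trace (H ** H)\<bar> \<le> 2 * real CARD('n) * K ^ 3 * \<bar>e\<bar> ^ 3"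
    and "\<bar>trace (H ** H)\<bar> \<le> real CARD('n) * K\<^sup>2"
    and "\<bar>trace H\<bar> \<le> real CARD('n) * K"
proof -
  show "posdef (mat 1 + e *\<^sub>R H)" unfolding posdef_def
  proof (intro conjI allI impI)
    have "transpose (mat 1 + e *\<^sub>R H) = mat 1 + e *\<^sub>R transpose H"
      by (auto simp: transpose_def vec_eq_iff mat_def)
    then show "transpose (mat 1 + e *\<^sub>R H) = mat 1 + e *\<^sub>R H" by (simp add: sym)
    fix v :: "real^'n" assume "v \<noteq> 0"
    have "\<bar>e * (v \<bullet> (H *v v))\<bar> \<le> \<bar>e\<bar> * (norm v * (K * norm v))"
      unfolding abs_mult
      by (intro mult_left_mono order_trans[OF Cauchy_Schwarz_ineq2] K) auto
    also have "\<dots> = (\<bar>e\<bar> * K) * (v \<bullet> v)" by (simp add: dot_square_norm power2_eq_square)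
    also have "\<dots> \<le> 1 / 2 * (v \<bullet> v)" by (intro mult_right_mono e) auto
    also have "\<dots> < v \<bullet> v" using \<open>v \<noteq> 0\<close> by simp
    finally show "v \<bullet> ((mat 1 + e *\<^sub>R H) *v v) > 0"
      by (simp add: matrix_vector_mult_add_rdistrib scaleR_matrix_vector_assoc[symmetric] inner_add_right)
  qed
  obtain Q d where Q: "orthogonal_matrix Q" "H = Q ** diag d ** transpose Q"
    "\<And>i. H *v column i Q = d i *\<^sub>R column i Q" "\<And>i. norm (column i Q) = 1"
    using symmetric_matrix_diagonalization[OF sym] by metis
  have d: "\<bar>d i\<bar> \<le> K" for i using K[of "column i Q"] Q(3,4) by simp
  \<comment> \<open>\<open>undefined\<close> merely names some index; any eigenvalue shows that
    \<open>K\<close> is nonnegative.\<close>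
  have K0: "K \<ge> 0" using d[of undefined] by linarith
  have small: "\<bar>e * d i\<bar> \<le> \<bar>e\<bar> * K" for i using d by (simp add: abs_mult mult_left_mono)
  have "mat 1 + e *\<^sub>R H = Q ** diag (\<lambda>i. 1 + e * d i) ** transpose Q"
  proof -
    have "diag (\<lambda>i. 1 + e * d i) = mat 1 + e *\<^sub>R diag d"
      by (simp add: diag_def mat_def vec_eq_iff)
    then have "Q ** diag (\<lambda>i. 1 + e * d i) ** transpose Q = Q ** transpose Q + e *\<^sub>R (Q ** diag d ** transpose Q)"
      by (simp add: matrix_add_ldistrib matrix_add_rdistrib matrix_mult_scaleR)
    then show ?thesis using Q(1) Q(2)[symmetric] by (simp add: orthogonal_matrix_def)
  qed
  then have det: "det (mat 1 + e *\<^sub>R H) = (\<Prod>i\<in>UNIV. 1 + e * d i)"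
    using Q(1) by (simp add: det_conj det_diag)
  have tr: "trace H = (\<Sum>i\<in>UNIV. d i)" using Q by (simp add: trace_conj trace_diag)
  have tr2: "trace (H ** H) = (\<Sum>i\<in>UNIV. d i * d i)"
    unfolding Q(2) by (simp add: conj_mult[OF Q(1)] trace_conj[OF Q(1)] diag_mult trace_diag)
  have "1 + e * d i > 0" for i using small[of i] e by linarith
  then have "e * trace H - ln (det (mat 1 + e *\<^sub>R H)) - e\<^sup>2 / 2 * trace (H ** H)
      = (\<Sum>i\<in>UNIV. e * d i - ln (1 + e * d i) - (e * d i)\<^sup>2 / 2)"
    unfolding det tr tr2
    by (simp add: ln_prod less_imp_neq[symmetric] sum_subtractf sum_distrib_left sum_divide_distrib power2_eq_square mult_ac)
  also have "\<bar>\<dots>\<bar> \<le> (\<Sum>i\<in>(UNIV::'n set). 2 * (\<bar>e\<bar> * K) ^ 3)"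
  proof (rule order_trans[OF sum_abs], rule sum_mono)
    fix i
    have "\<bar>e * d i\<bar> ^ 3 \<le> (\<bar>e\<bar> * K) ^ 3" by (rule power_mono[OF small]) simp
    then show "\<bar>e * d i - ln (1 + e * d i) - (e * d i)\<^sup>2 / 2\<bar> \<le> 2 * (\<bar>e\<bar> * K) ^ 3"
      using ln_one_plus_cubic_bound[of "e * d i"] small[of i] e by linarith
  qed
  finally show "\<bar>e * trace H - ln (det (mat 1 + e *\<^sub>R H)) - e\<^sup>2 / 2 * trace (H ** H)\<bar> \<le> 2 * real CARD('n) * K ^ 3 * \<bar>e\<bar> ^ 3"
    by (simp add: power_mult_distrib mult_ac)
  have "d i * d i \<le> K * K" for i
    using mult_mono[OF d[of i] d[of i] K0 abs_ge_zero] by (simp only: abs_mult_self_eq)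
  then show "\<bar>trace (H ** H)\<bar> \<le> real CARD('n) * K\<^sup>2" unfolding tr2
    using sum_bounded_above[of UNIV "\<lambda>i. \<bar>d i * d i\<bar>" "K\<^sup>2"]
    by (intro order_trans[OF sum_abs]) (simp add: abs_mult power2_eq_square)
  show "\<bar>trace H\<bar> \<le> real CARD('n) * K" unfolding tr
    using sum_bounded_above[of UNIV "\<lambda>i. \<bar>d i\<bar>" K] d by (intro order_trans[OF sum_abs]) simp
qed

subsection \<open>Uniqueness of the transport map\<close>

text \<open>The set of equality is closed, and a closed set of full Lebesgue measure is the whole
  space.\<close>

lemma AE_lborel_continuous_eq:
  fixes f g :: "'a::euclidean_space \<Rightarrow> real"
  assumes "continuous_on UNIV f" "continuous_on UNIV g" "AE x in lborel. f x = g x"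
  shows "f x = g x"
proof -
  have "closed {x. f x = g x}" using assms(1,2) by (simp add: closed_Collect_eq)
  moreover have "AE x in lebesgue. x \<in> {x. f x = g x}"
    using assms(3) by (simp add: AE_completion)
  ultimately show ?thesis using mem_closed_if_AE_lebesgue by blast
qed

lemma smooth_borel_measurable [measurable_dest]: "smooth f \<Longrightarrow> f \<in> borel_measurable borel"
  by (simp add: borel_measurable_continuous_onI smooth_imp_continuous_on)

lemma smooth_map_continuous: "smooth_map F \<Longrightarrow> continuous_on UNIV F"
  unfolding smooth_map_def by (subst continuous_on_componentwise) (auto simp: Basis_vec_def inner_axis smooth_imp_continuous_on)

lemma is_densityD:
  assumes "is_density q"
  shows "smooth q" "\<And>x. q x > 0" "integrable lborel q" "(LINT x|lborel. q x) = 1"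
    "q \<in> borel_measurable borel" "continuous_on UNIV q"
  using assms by (auto simp: is_density_def smooth_borel_measurable smooth_imp_continuous_on)

lemma finite_measure_is_density:
  assumes "is_density q"
  shows "finite_measure (density lborel (\<lambda>x. ennreal (q x)))"
proof
  note q = is_densityD[OF assms]
  have "(\<integral>\<^sup>+x. ennreal (q x) \<partial>lborel) = 1"
    using q by (subst nn_integral_eq_integral) (auto intro: less_imp_le)
  then show "emeasure (density lborel (\<lambda>x. ennreal (q x))) (space (density lborel (\<lambda>x. ennreal (q x)))) \<noteq> \<infinity>"
    using q by (simp add: emeasure_density)
qed

text \<open>The two sides are asymmetric on purpose. Only \<open>Psi\<close> has to be admissible,
  which provides the continuous inverse; \<open>Phi\<close> may be an explicit candidate known only
  to be strictly convex and to push \<open>q\<close> to \<open>p\<close>.\<close>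

theorem transport_map_unique:
  fixes Phi :: "real^'n::finite \<Rightarrow> real"
  assumes q: "is_density q"
    and Phi: "smooth Phi" "\<And>x v. v \<noteq> 0 \<Longrightarrow> v \<bullet> (hess Phi x *v v) > 0" "pushes (grad Phi) q p"
    and Psi: "admissible_pot p q Psi"
  shows "grad Phi = grad Psi"
proof -
  define M where "M = density lborel (\<lambda>x. ennreal (q x))"
  interpret M: finite_measure M unfolding M_def by (rule finite_measure_is_density[OF q])
  note qd = is_densityD[OF q]
  define T where "T = grad Phi"
  define U where "U = grad Psi"
  define V where "V = inv U"
  define S where "S = (\<lambda>x. V (T x))"
  have Psi': "smooth Psi" "\<And>x v. v \<noteq> 0 \<Longrightarrow> v \<bullet> (hess Psi x *v v) > 0" "pushes U q p" "diffeo U"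
    using Psi by (auto simp: admissible_pot_def brenier_potential_def U_def)
  have bij: "bij U" and contV: "continuous_on UNIV V"
    using Psi'(4) by (auto simp: diffeo_def V_def smooth_map_continuous)
  have UV: "U (V y) = y" "V (U y) = y" for y
    using bij by (simp_all add: V_def bij_is_surj surj_f_inv_f bij_is_inj)
  have contT: "continuous_on UNIV T" "continuous_on UNIV U"
    unfolding T_def U_def by (intro continuous_grad Phi Psi')+
  have contS: "continuous_on UNIV S"
    unfolding S_def by (rule continuous_on_compose2[OF contV contT(1)]) auto
  have [measurable]: "T \<in> borel_measurable borel" "U \<in> borel_measurable borel" "V \<in> borel_measurable borel"
    "S \<in> borel_measurable borel" "Phi \<in> borel_measurable borel" "Psi \<in> borel_measurable borel"
    using contT contV contS Phi(1) Psi'(1)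
    by (simp_all add: borel_measurable_continuous_onI smooth_borel_measurable)
  have setsM [measurable_cong]: "sets M = sets borel" by (simp add: M_def)
  have "distr M lborel T = distr M lborel U"
    using Phi(3) Psi'(3) by (simp add: pushes_def M_def T_def)
  then have "distr (distr M lborel T) borel V = distr (distr M lborel U) borel V" by simp
  then have "distr M borel S = distr M borel (\<lambda>x. x)"
    by (simp add: distr_distr o_def S_def UV)
  then have S: "distr M borel S = M" by (simp add: distr_id2 setsM)
  define f where "f = (\<lambda>x. Phi x - Psi x)"
  have [measurable]: "f \<in> borel_measurable borel" unfolding f_def by measurable
  have contf: "continuous_on UNIV f"
    unfolding f_def by (intro continuous_on_diff smooth_imp_continuous_on Phi Psi')
  have tangent: "h y \<ge> h x + grad h x \<bullet> (y - x)"
    if "smooth h" "\<And>x v. v \<noteq> 0 \<Longrightarrow> v \<bullet> (hess h x *v v) > 0" for h :: "real^'n \<Rightarrow> real" and x y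
    using strict_tangent_inequality[OF that, of x y] by (cases "x = y") auto
  have grad_eq: "grad Psi (S m) = grad Phi m" for m
    using UV by (simp add: S_def U_def T_def)
  \<comment> \<open>The tangent of \<open>Psi\<close> is taken at \<open>S m\<close>, where its
    gradient equals that of \<open>Phi\<close> at \<open>m\<close>. Both tangent inequalities thus
    involve the same vector, and the linear terms cancel on addition.\<close>
  have psi: "Psi m \<ge> Psi (S m) + grad Phi m \<bullet> (m - S m)" for m
    using tangent[OF Psi'(1,2), of "S m" m] by (simp add: grad_eq)
  have fS: "f (S m) \<ge> f m" for m
    using psi[of m] tangent[OF Phi(1,2), of m "S m"] by (simp add: f_def inner_diff_right)
  have arctan_le: "\<bar>arctan y\<bar> \<le> pi / 2" for y
    using arctan_lbound[of y] arctan_ubound[of y] by linarith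
  have int: "integrable M (\<lambda>x. arctan (f x))" "integrable M (\<lambda>x. arctan (f (S x)))"
    using arctan_le by (auto intro!: M.integrable_const_bound[where B = "pi / 2"])
  have "(LINT x|M. arctan (f (S x))) = (LINT x|distr M borel S. arctan (f x))"
    by (subst integral_distr) auto
  then have "(LINT x|M. arctan (f (S x)) - arctan (f x)) = 0"
    using int by (simp add: S)
  moreover have "AE x in M. 0 \<le> arctan (f (S x)) - arctan (f x)"
    using fS by (simp add: arctan_le_iff)
  ultimately have "AE x in M. arctan (f (S x)) - arctan (f x) = 0"
    using int by (subst (asm) integral_nonneg_eq_0_iff_AE) auto
  \<comment> \<open>Positivity of \<open>q\<close> makes null sets of \<open>M\<close> null for
    Lebesgue measure, and injectivity of \<open>arctan\<close> removes it.\<close>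
  then have "AE x in lborel. f (S x) = f x"
    unfolding M_def using qd by (subst (asm) AE_density) (auto simp: arctan_eq_iff)
  moreover have "continuous_on UNIV (\<lambda>x. f (S x))"
    by (rule continuous_on_compose2[OF contf contS]) auto
  ultimately have eq: "f (S x) = f x" for x using AE_lborel_continuous_eq contf by metis
  have "S x = x" for x
  proof (rule ccontr)
    assume "S x \<noteq> x"
    \<comment> \<open>Equality of \<open>f\<close> at \<open>x\<close> and \<open>S x\<close> leaves
      no slack in the sum of the two tangent inequalities, but that of \<open>Phi\<close> is strict
      at distinct points.\<close>
    then have "Phi (S x) > Phi x + grad Phi x \<bullet> (S x - x)"
      using strict_tangent_inequality[OF Phi(1,2), of x "S x"] by simp
    with psi[of x] eq[of x] show False by (simp add: f_def inner_diff_right)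
  qed
  with grad_eq show ?thesis by (metis ext)
qed

section \<open>Independence of the divergence from the chosen potential\<close>

lemma hess_cong: "grad f = grad g \<Longrightarrow> hess f = hess g"
proof -
  assume "grad f = grad g"
  then have "partial i f x = partial i g x" for i x
    by (metis grad_def vec_lambda_beta)
  then have "partial i f = partial i g" for i by (rule ext)
  then show ?thesis by (simp add: hess_def[abs_def])
qed

text \<open>Some admissible potential must exist for the choice operator to be meaningful; given
  that, the formula may be evaluated with a \<open>Phi\<close> whose admissibility has not been
  established. Uniqueness fixes only the gradient, which determines the Hessian.\<close>

theorem D_TKL_eq:
  fixes Phi :: "real^'n::finite \<Rightarrow> real"
  assumes q: "is_density q"
    and Phi: "smooth Phi" "\<And>x v. v \<noteq> 0 \<Longrightarrow> v \<bullet> (hess Phi x *v v) > 0" "pushes (grad Phi) q p"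
    and ex: "admissible_pot p q Psi"
  shows "D_TKL p q = (LINT x|lborel. (lap Phi x - ln (det (hess Phi x)) - real CARD('n)) * q x)"
proof -
  have "admissible_pot p q (SOME Psi. admissible_pot p q Psi)" using ex by (rule someI[where P = "admissible_pot p q"])
  from hess_cong[OF transport_map_unique[OF q Phi this]]
  show ?thesis by (simp add: D_TKL_def lap_def Let_def)
qed

lemma admissible_potD:
  assumes "admissible_pot p q Phi"
  shows "smooth Phi" "\<And>x v. v \<noteq> 0 \<Longrightarrow> v \<bullet> (hess Phi x *v v) > 0" "pushes (grad Phi) q p"
    "convex_on UNIV Phi" "diffeo (grad Phi)" "\<And>x. p (grad Phi x) * det (hess Phi x) = q x"
    "integrable lborel (\<lambda>x. q x * lap Phi x)" "integrable lborel (\<lambda>x. q x * ln (det (hess Phi x)))"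
    "\<And>x. posdef (hess Phi x)"
  using assms by (auto simp: admissible_pot_def brenier_potential_def posdef_def transpose_hess)

lemma D_TKL_admissible_pot:
  fixes Phi :: "real^'n::finite \<Rightarrow> real"
  assumes "is_density q" "admissible_pot p q Phi"
  shows "D_TKL p q = (LINT x|lborel. (lap Phi x - ln (det (hess Phi x)) - real CARD('n)) * q x)"
  by (rule D_TKL_eq[OF assms(1) _ _ _ assms(2)]) (use admissible_potD[OF assms(2)] in auto)

lemma integrable_D_TKL:
  fixes Phi :: "real^'n::finite \<Rightarrow> real"
  assumes "is_density q" "admissible_pot p q Phi"
  shows "integrable lborel (\<lambda>x. (lap Phi x - ln (det (hess Phi x)) - real CARD('n)) * q x)"
proof -
  have "integrable lborel (\<lambda>x. q x * lap Phi x - q x * ln (det (hess Phi x)) - real CARD('n) * q x)"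
    using admissible_potD[OF assms(2)] is_densityD[OF assms(1)] by auto
  then show ?thesis by (simp add: algebra_simps)
qed

subsection \<open>Nonnegativity and transport convexity\<close>

lemma continuous_ln_det_hess:
  assumes "smooth Phi" "\<And>x. posdef (hess Phi x)"
  shows "continuous_on UNIV (\<lambda>x. ln (det (hess Phi x)))"
  using smooth_imp_continuous_on[OF smooth_det[OF hess_component_smooth[OF assms(1)]]] posdef_det_pos[OF assms(2)]
  by (intro continuous_on_ln) (auto simp: less_imp_neq[symmetric])

lemma grad_eq_translation:
  fixes Phi :: "real^'n::finite \<Rightarrow> real"
  assumes "smooth Phi" "\<And>x. hess Phi x = mat 1"
  obtains c where "\<And>x. grad Phi x = x + c"
proof -
  have "((\<lambda>x. grad Phi x - x) has_derivative (\<lambda>h. 0)) (at x)" for x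
    using has_derivative_diff[OF grad_has_derivative[OF assms(1), of x] has_derivative_ident] assms(2) by simp
  then obtain c where "\<And>x. grad Phi x - x = c"
    using has_derivative_zero_constant[of UNIV "\<lambda>x. grad Phi x - x"] by auto
  then show ?thesis using that[of c] by (metis add.commute diff_add_cancel)
qed

text \<open>Half the squared norm plus a linear term: the potential of the translation by
  \<open>c\<close>. With \<open>c = 0\<close> it is the potential of the identity, to which
  perturbations are added later.\<close>

lemma quadratic_potential:
  fixes c :: "real^'n::finite"
  defines "Phi \<equiv> \<lambda>x. \<Sum>i\<in>UNIV. (1/2) * (x $ i * x $ i) + c $ i * x $ i"
  shows "smooth Phi" "grad Phi x = x + c" "hess Phi x = mat 1"
proof -
  show sm: "smooth Phi" unfolding Phi_def
    by (intro smooth_sum smooth_add smooth_mult smooth_const smooth_coord) auto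
  have coord: "((\<lambda>x. x $ i) has_derivative (\<lambda>h. h $ i)) (at x)" for i and x :: "real^'n"
    by (rule linear_imp_has_derivative) (simp add: linear_iff)
  have "(Phi has_derivative (\<lambda>h. \<Sum>i\<in>UNIV. (x $ i + c $ i) * h $ i)) (at x)" for x
    unfolding Phi_def by (auto intro!: derivative_eq_intros coord simp: algebra_simps)
  from partial_eqI[OF this] have p: "partial i Phi x = x $ i + c $ i" for i x
    by (simp add: axis_def if_distrib sum.delta cong: if_cong)
  show "grad Phi x = x + c" by (simp add: grad_def vec_eq_iff p)
  have "partial i Phi = (\<lambda>x. x $ i + c $ i)" for i by (rule ext) (rule p)
  then have "partial j (partial i Phi) x = (if j = i then 1 else 0)" for i j x
    by (simp add: partial_add_smooth smooth_coord smooth_const partial_coord partial_const)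
  then show "hess Phi x = mat 1" by (auto simp: hess_def mat_def vec_eq_iff)
qed

lemma pushes_translation:
  fixes p q :: "real^'n::finite \<Rightarrow> real"
  assumes [measurable]: "p \<in> borel_measurable borel" and "\<And>x. p (x + c) = q x"
  shows "pushes (\<lambda>x. x + c) q p"
proof -
  have lb: "lborel = distr lborel borel (\<lambda>x. c + 1 *\<^sub>R x :: real^'n)"
    using lborel_affine[of 1 c] by (simp add: density_1)
  have "density lborel (\<lambda>x. ennreal (p x)) = density (distr lborel borel (\<lambda>x. c + 1 *\<^sub>R x)) (\<lambda>x. ennreal (p x))"
    using lb by simp
  also have "\<dots> = distr (density lborel (\<lambda>x. ennreal (p (c + 1 *\<^sub>R x)))) borel (\<lambda>x. c + 1 *\<^sub>R x)"
    by (rule density_distr) auto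
  also have "\<dots> = distr (density lborel (\<lambda>x. ennreal (q x))) lborel (\<lambda>x. x + c)"
    using assms(2) by (intro distr_cong) (auto simp: add.commute)
  finally show ?thesis by (simp add: pushes_def)
qed

theorem D_TKL_nonneg:
  assumes "admissible p q"
  shows "D_TKL p q \<ge> 0"
proof -
  obtain Phi where Phi: "is_density q" "admissible_pot p q Phi" using assms by (auto simp: admissible_def)
  show ?thesis unfolding D_TKL_admissible_pot[OF Phi]
    using trace_ln_det_inequality(1)[OF admissible_potD(9)[OF Phi(2)]] is_densityD(2)[OF Phi(1)]
    by (intro integral_nonneg_AE AE_I2 mult_nonneg_nonneg) (auto simp: lap_def less_imp_le)
qed

text \<open>If the divergence vanishes, so does the nonnegative continuous integrand everywhere;
  then the Hessian is the identity, the map is a translation, and the Jacobian equation gives the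
  claim. Conversely the quadratic potential evaluates the divergence.\<close>

theorem D_TKL_eq_0_iff:
  fixes p q :: "real^'n::finite \<Rightarrow> real"
  assumes "admissible p q"
  shows "D_TKL p q = 0 \<longleftrightarrow> (\<exists>c. \<forall>x. p (x + c) = q x)"
proof
  obtain Phi where Phi: "is_density q" "admissible_pot p q Phi" using assms by (auto simp: admissible_def)
  note P = admissible_potD[OF Phi(2)] and qd = is_densityD[OF Phi(1)]
  let ?I = "\<lambda>x. (lap Phi x - ln (det (hess Phi x)) - real CARD('n)) * q x"
  have nn: "?I x \<ge> 0" for x
    using trace_ln_det_inequality(1)[OF P(9)] qd(2) by (simp add: lap_def less_imp_le)
  assume "D_TKL p q = 0"
  then have "AE x in lborel. ?I x = 0"
    unfolding D_TKL_admissible_pot[OF Phi]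
    by (subst (asm) integral_nonneg_eq_0_iff_AE[OF integrable_D_TKL[OF Phi]]) (use nn in auto)
  moreover have "continuous_on UNIV ?I"
    by (intro continuous_intros continuous_ln_det_hess P smooth_imp_continuous_on smooth_lap qd)
  ultimately have "?I x = 0" for x
    by (intro AE_lborel_continuous_eq[of ?I "\<lambda>_. 0"] continuous_on_const)
  then have "trace (hess Phi x) - ln (det (hess Phi x)) - real CARD('n) = 0" for x
    using qd(2)[of x] by (metis lap_def less_irrefl mult_eq_0_iff)
  then have H: "hess Phi x = mat 1" for x using trace_ln_det_inequality(2)[OF P(9)] by blast
  obtain c where "\<And>x. grad Phi x = x + c" using grad_eq_translation[OF P(1) H] by blast
  with P(6) H show "\<exists>c. \<forall>x. p (x + c) = q x" by (metis det_I mult.right_neutral)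
next
  obtain Phi where Phi: "is_density q" "admissible_pot p q Phi" "is_density p" using assms by (auto simp: admissible_def)
  assume "\<exists>c. \<forall>x. p (x + c) = q x"
  then obtain c where c: "\<And>x. p (x + c) = q x" by blast
  define Psi where "Psi = (\<lambda>x. \<Sum>i\<in>UNIV. (1/2) * (x $ i * x $ i) + c $ i * x $ i)"
  note Q = quadratic_potential[of c, folded Psi_def]
  have "grad Psi = (\<lambda>x. x + c)" using Q(2) by (rule ext)
  then have "pushes (grad Psi) q p" using pushes_translation[OF is_densityD(5)[OF Phi(3)] c] by simp
  then have "D_TKL p q = (LINT x|lborel. (lap Psi x - ln (det (hess Psi x)) - real CARD('n)) * q x)"
    by (intro D_TKL_eq[OF Phi(1) Q(1) _ _ Phi(2)]) (simp_all add: Q)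
  then show "D_TKL p q = 0" by (simp add: Q lap_def trace_I)
qed

theorem D_TKL_transport_convex:
  fixes q :: "real^'n::finite \<Rightarrow> real"
  assumes q: "is_density q" and 1: "admissible_pot p1 q Phi1" and 2: "admissible_pot p2 q Phi2"
    and l: "l \<in> {0..1}" and push: "pushes (\<lambda>x. l *\<^sub>R grad Phi1 x + (1 - l) *\<^sub>R grad Phi2 x) q pl"
    and adm: "admissible pl q"
  shows "D_TKL pl q \<le> l * D_TKL p1 q + (1 - l) * D_TKL p2 q"
proof -
  note P1 = admissible_potD[OF 1] and P2 = admissible_potD[OF 2]
  note qd = is_densityD[OF q]
  obtain Psi where Psi: "admissible_pot pl q Psi" using adm by (auto simp: admissible_def)
  define Phi where "Phi = (\<lambda>x. l * Phi1 x + (1 - l) * Phi2 x)"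
  have sm: "smooth (\<lambda>x. l * Phi1 x)" "smooth (\<lambda>x. (1 - l) * Phi2 x)"
    by (intro smooth_mult smooth_const P1 P2)+
  have smP: "smooth Phi" unfolding Phi_def by (intro smooth_add sm)
  have g: "grad Phi = (\<lambda>x. l *\<^sub>R grad Phi1 x + (1 - l) *\<^sub>R grad Phi2 x)"
    by (rule ext) (simp add: Phi_def grad_add[OF sm] grad_scale P1(1) P2(1))
  have h: "hess Phi x = l *\<^sub>R hess Phi1 x + (1 - l) *\<^sub>R hess Phi2 x" for x
    by (simp add: Phi_def hess_add[OF sm] hess_scale P1(1) P2(1))
  have pd: "posdef (hess Phi x)" for x
    unfolding h using l by (intro posdef_convex_combination P1 P2) auto
  \<comment> \<open>The combined potential is not known to be admissible for \<open>pl\<close>;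
    uniqueness identifies its gradient with that of \<open>Psi\<close>, from which integrability is
    taken.\<close>
  have gp: "grad Phi = grad Psi"
    using pd push by (intro transport_map_unique[OF q smP _ _ Psi]) (auto simp: g posdef_def)
  have hp: "hess Phi = hess Psi" by (rule hess_cong[OF gp])
  let ?n = "real CARD('n)"
  let ?I = "\<lambda>F x. (lap F x - ln (det (hess F x)) - ?n) * q x"
  have D: "D_TKL pl q = (LINT x|lborel. ?I Psi x)" "D_TKL p1 q = (LINT x|lborel. ?I Phi1 x)" "D_TKL p2 q = (LINT x|lborel. ?I Phi2 x)"
    using D_TKL_admissible_pot[OF q] 1 2 Psi by auto
  have int: "integrable lborel (?I Psi)" "integrable lborel (?I Phi1)" "integrable lborel (?I Phi2)"
    using integrable_D_TKL[OF q] 1 2 Psi by auto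
  have le: "?I Psi x \<le> l * ?I Phi1 x + (1 - l) * ?I Phi2 x" for x
  proof -
    have "lap Psi x = l * lap Phi1 x + (1 - l) * lap Phi2 x"
      unfolding lap_def hp[symmetric] h by (simp add: trace_add trace_scaleR)
    moreover have "l * ln (det (hess Phi1 x)) + (1 - l) * ln (det (hess Phi2 x)) \<le> ln (det (hess Psi x))"
      unfolding hp[symmetric] h using l by (intro ln_det_concave P1 P2) auto
    ultimately have "lap Psi x - ln (det (hess Psi x)) - ?n
      \<le> l * (lap Phi1 x - ln (det (hess Phi1 x)) - ?n) + (1 - l) * (lap Phi2 x - ln (det (hess Phi2 x)) - ?n)"
      by (simp add: algebra_simps)
    from mult_right_mono[OF this, of "q x"] qd(2)[of x] show ?thesis by (simp add: algebra_simps less_imp_le)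
  qed
  have "D_TKL pl q \<le> (LINT x|lborel. l * ?I Phi1 x + (1 - l) * ?I Phi2 x)"
    unfolding D by (intro integral_mono int Bochner_Integration.integrable_add integrable_mult_right le)
  also have "\<dots> = l * D_TKL p1 q + (1 - l) * D_TKL p2 q"
    unfolding D using int by simp
  finally show ?thesis .
qed

subsection \<open>Reindexing coordinates\<close>

text \<open>One notion for two uses: with \<open>Inl\<close> and \<open>Inr\<close> it projects a
  product space onto its factors, with a bijection it relabels coordinates.\<close>

definition reindex :: "('a \<Rightarrow> 'b) \<Rightarrow> real^'b::finite \<Rightarrow> real^'a::finite" where
  "reindex h z = (\<chi> i. z $ h i)"

lemma reindex_nth [simp]: "reindex h z $ i = z $ h i"
  by (simp add: reindex_def)

lemma linear_reindex: "linear (reindex h)"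
  by (simp add: linear_iff vec_eq_iff)

lemma reindex_axis:
  assumes "inj h"
  shows "reindex h (z + t *\<^sub>R axis (h i) 1) = reindex h z + t *\<^sub>R axis i 1"
    and "k \<notin> range h \<Longrightarrow> reindex h (z + t *\<^sub>R axis k 1) = reindex h z"
  using assms by (auto simp: vec_eq_iff axis_def inj_eq)

lemma partial_reindex:
  assumes "inj h"
  shows "partial (h i) (\<lambda>z. f (reindex h z)) = (\<lambda>z. partial i f (reindex h z))"
    and "k \<notin> range h \<Longrightarrow> partial k (\<lambda>z. f (reindex h z)) = (\<lambda>z. 0)"
  by (auto simp: partial_def[abs_def] reindex_axis[OF assms])

lemma smooth_reindex:
  assumes h: "inj h" and "smooth f"
  shows "smooth (\<lambda>z. f (reindex h z))"
proof (rule smooth_coinduct[of "\<lambda>g. \<exists>f. smooth f \<and> g = (\<lambda>z. f (reindex h z))"])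
  show "\<exists>f'. smooth f' \<and> (\<lambda>z. f (reindex h z)) = (\<lambda>z. f' (reindex h z))" using assms by blast
next
  fix g and x :: "real^'b" assume "\<exists>f. smooth f \<and> g = (\<lambda>z. f (reindex h z))"
  then obtain f where f: "smooth f" "g = f \<circ> reindex h" by (auto simp: o_def)
  show "g differentiable (at x)" unfolding f
    by (rule differentiable_chain_at)
      (auto intro: linear_imp_differentiable linear_reindex smooth_differentiable f)
next
  fix g and k :: 'b assume "\<exists>f. smooth f \<and> g = (\<lambda>z. f (reindex h z))"
  then obtain f where f: "smooth f" "g = (\<lambda>z. f (reindex h z))" by blast
  show "\<exists>f. smooth f \<and> partial k g = (\<lambda>z. f (reindex h z))"
  proof (cases "k \<in> range h")
    case True
    then show ?thesis using f partial_reindex(1)[OF h] smooth_partial by blast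
  next
    case False
    then show ?thesis using f partial_reindex(2)[OF h False] smooth_const[of 0]
      by (intro exI[of _ "\<lambda>_. 0"]) simp
  qed
qed

lemma continuous_reindex: "continuous_on UNIV (reindex h)"
  by (rule linear_continuous_on) (simp add: linear_reindex linear_linear)

lemma measurable_reindex [measurable]: "reindex h \<in> borel_measurable borel"
  by (rule borel_measurable_continuous_onI[OF continuous_reindex])

lemma reindex_join [simp]: "reindex Inl (join x y) = x" "reindex Inr (join x y) = y"
  by (simp_all add: join_def vec_eq_iff)

lemma join_nth [simp]: "join x y $ Inl i = x $ i" "join x y $ Inr j = y $ j"
  by (simp_all add: join_def)

lemma join_reindex [simp]: "join (reindex Inl z) (reindex Inr z) = z"
  by (simp add: join_def vec_eq_iff split: sum.split)

lemma sum_UNIV_Plus: "(\<Sum>k\<in>UNIV. f k) = (\<Sum>i\<in>UNIV. f (Inl i)) + (\<Sum>j\<in>UNIV. f (Inr j))"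
  for f :: "'a::finite + 'b::finite \<Rightarrow> 'c::comm_monoid_add"
  by (simp add: UNIV_Plus_UNIV[symmetric] sum.Plus del: UNIV_Plus_UNIV)

lemma prod_UNIV_Plus: "(\<Prod>k\<in>UNIV. f k) = (\<Prod>i\<in>UNIV. f (Inl i)) * (\<Prod>j\<in>UNIV. f (Inr j))"
  for f :: "'a::finite + 'b::finite \<Rightarrow> 'c::comm_monoid_mult"
  by (simp add: UNIV_Plus_UNIV[symmetric] prod.Plus del: UNIV_Plus_UNIV)

lemma all_sum: "(\<forall>k. P k) \<longleftrightarrow> (\<forall>i. P (Inl i)) \<and> (\<forall>j. P (Inr j))"
  by (metis sum.exhaust)

subsection \<open>Block diagonal matrices\<close>

definition block :: "real^'a::finite^'a \<Rightarrow> real^'b::finite^'b \<Rightarrow> real^('a + 'b)^('a + 'b)" where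
  "block A B = (\<chi> k l. case k of
      Inl i \<Rightarrow> (case l of Inl j \<Rightarrow> A $ i $ j | Inr j \<Rightarrow> 0)
    | Inr i \<Rightarrow> (case l of Inl j \<Rightarrow> 0 | Inr j \<Rightarrow> B $ i $ j))"

lemma block_nth [simp]:
  "block A B $ Inl i $ Inl j = A $ i $ j" "block A B $ Inl i $ Inr l = 0"
  "block A B $ Inr k $ Inl j = 0" "block A B $ Inr k $ Inr l = B $ k $ l"
  by (simp_all add: block_def)

lemma block_mult: "block A B ** block C D = block (A ** C) (B ** D)"
  by (simp add: vec_eq_iff all_sum matrix_matrix_mult_def sum_UNIV_Plus)

lemma transpose_block: "transpose (block A B) = block (transpose A) (transpose B)"
  by (simp add: vec_eq_iff all_sum transpose_def)

lemma block_1: "block (mat 1) (mat 1) = mat 1"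
  by (simp add: vec_eq_iff all_sum mat_def)

lemma trace_block: "trace (block A B) = trace A + trace B"
  by (simp add: trace_def sum_UNIV_Plus)

lemma block_diag: "block (diag d) (diag e) = diag (case_sum d e)"
  by (simp add: vec_eq_iff all_sum diag_def)

text \<open>Diagonalising both blocks turns the determinant into a product over the sum type, which
  splits. Symmetry is available since the blocks will be Hessians.\<close>

lemma det_block:
  assumes "transpose A = A" "transpose B = B"
  shows "det (block A B) = det A * det B"
proof -
  obtain Q d where Q: "orthogonal_matrix Q" "A = Q ** diag d ** transpose Q"
    using symmetric_matrix_diagonalization[OF assms(1)] by blast
  obtain R e where R: "orthogonal_matrix R" "B = R ** diag e ** transpose R"
    using symmetric_matrix_diagonalization[OF assms(2)] by blast
  have "orthogonal_matrix (block Q R)"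
    using Q(1) R(1) by (simp add: orthogonal_matrix_def transpose_block block_mult block_1)
  moreover have "block A B = block Q R ** diag (case_sum d e) ** transpose (block Q R)"
    by (simp add: Q(2) R(2) transpose_block block_mult block_diag[symmetric])
  ultimately have "det (block A B) = (\<Prod>k\<in>UNIV. case_sum d e k)" by (simp add: det_conj det_diag)
  then show ?thesis by (simp add: prod_UNIV_Plus Q R det_conj det_diag)
qed

lemma block_mult_vec: "block A B *v z = join (A *v reindex Inl z) (B *v reindex Inr z)"
  by (simp add: vec_eq_iff all_sum matrix_vector_mult_def sum_UNIV_Plus)

lemma inner_join: "z \<bullet> join x y = reindex Inl z \<bullet> x + reindex Inr z \<bullet> y"
  by (simp add: inner_vec_def sum_UNIV_Plus)

subsection \<open>Lebesgue measure on a product\<close>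

lemma Basis_vec_eq: "(Basis :: (real^'n::finite) set) = range (\<lambda>i. axis i 1)"
  by (auto simp: Basis_vec_def)

lemma prod_Basis_vec: "(\<Prod>b\<in>(Basis :: (real^'n::finite) set). f b) = (\<Prod>i\<in>UNIV. f (axis i 1))"
proof -
  have "inj (\<lambda>i::'n. axis i (1::real))" by (simp add: inj_def axis_eq_axis)
  then show ?thesis by (simp add: Basis_vec_eq prod.reindex)
qed

lemma emeasure_lborel_box_vec:
  fixes l u :: "real^'n::finite"
  assumes "\<And>i. l $ i \<le> u $ i"
  shows "emeasure lborel (box l u) = ennreal (\<Prod>i\<in>UNIV. u $ i - l $ i)"
proof -
  have "\<forall>b\<in>Basis. l \<bullet> b \<le> u \<bullet> b" using assms by (auto simp: Basis_vec_eq inner_axis)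
  then show ?thesis by (simp add: emeasure_lborel_box_eq prod_Basis_vec inner_axis)
qed

lemma linear_join: "linear (\<lambda>(x, y). join x y)"
  by (simp add: linear_iff vec_eq_iff all_sum split_beta)

lemma continuous_join: "continuous_on UNIV (\<lambda>(x, y). join x y)"
  by (rule linear_continuous_on) (simp add: linear_join linear_linear)

lemma measurable_join [measurable]: "(\<lambda>(x, y). join x y) \<in> borel \<Otimes>\<^sub>M borel \<rightarrow>\<^sub>M borel"
  unfolding borel_prod by (rule borel_measurable_continuous_onI[OF continuous_join])

text \<open>Lebesgue measure is determined by its values on boxes, and a box in the joined space is
  a product of boxes.\<close>

lemma lborel_join:
  "distr (lborel \<Otimes>\<^sub>M lborel) borel (\<lambda>(x, y). join x y) = (lborel :: (real^('a::finite + 'b::finite)) measure)"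
proof (rule lborel_eqI[symmetric])
  fix l u :: "real^('a + 'b)" assume "\<And>b. b \<in> Basis \<Longrightarrow> l \<bullet> b \<le> u \<bullet> b"
  then have lu: "l $ k \<le> u $ k" for k
    using inner_axis[of l k 1] inner_axis[of u k 1] by (metis Basis_vec_eq rangeI inner_real_def mult.right_neutral)
  have "(\<lambda>(x, y). join x y) -` box l u \<inter> space (lborel \<Otimes>\<^sub>M lborel)
      = box (reindex Inl l) (reindex Inl u) \<times> box (reindex Inr l) (reindex Inr u)"
    by (auto simp: box_def Basis_vec_eq inner_axis all_sum space_pair_measure)
  then have "emeasure (distr (lborel \<Otimes>\<^sub>M lborel) borel (\<lambda>(x, y). join x y)) (box l u)
      = emeasure lborel (box (reindex Inl l) (reindex Inl u)) * emeasure lborel (box (reindex Inr l) (reindex Inr u))"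
    by (subst emeasure_distr) (auto simp: lborel.emeasure_pair_measure_Times)
  also have "\<dots> = ennreal (\<Prod>i\<in>UNIV. u $ Inl i - l $ Inl i) * ennreal (\<Prod>j\<in>UNIV. u $ Inr j - l $ Inr j)"
    using lu by (simp add: emeasure_lborel_box_vec)
  also have "\<dots> = ennreal ((\<Prod>i\<in>UNIV. u $ Inl i - l $ Inl i) * (\<Prod>j\<in>UNIV. u $ Inr j - l $ Inr j))"
    using lu by (intro ennreal_mult[symmetric] prod_nonneg) auto
  also have "\<dots> = (\<Prod>b\<in>Basis. (u - l) \<bullet> b)"
    by (simp add: prod_Basis_vec inner_axis prod_UNIV_Plus)
  finally show "emeasure (distr (lborel \<Otimes>\<^sub>M lborel) borel (\<lambda>(x, y). join x y)) (box l u) = (\<Prod>b\<in>Basis. (u - l) \<bullet> b)" .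
qed simp

lemma integral_join_product:
  fixes f :: "real^'a::finite \<Rightarrow> real" and g :: "real^'b::finite \<Rightarrow> real"
  assumes f: "integrable lborel f" and g: "integrable lborel g"
  shows "integrable lborel (\<lambda>z. f (reindex Inl z) * g (reindex Inr z))"
    and "(LINT z|lborel. f (reindex Inl z) * g (reindex Inr z)) = (LINT x|lborel. f x) * (LINT y|lborel. g y)"
proof -
  have [measurable]: "f \<in> borel_measurable borel" "g \<in> borel_measurable borel"
    using borel_measurable_integrable[OF f] borel_measurable_integrable[OF g] by auto
  have int: "integrable (lborel \<Otimes>\<^sub>M lborel) (\<lambda>(x, y). f x * g y)"
  proof (rule lborel_pair.Fubini_integrable)
    have "(\<lambda>x. LINT y|lborel. norm (case (x, y) of (x, y) \<Rightarrow> f x * g y)) = (\<lambda>x. norm (f x) * (LINT y|lborel. norm (g y)))"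
      by (simp add: norm_mult abs_mult)
    then show "integrable lborel (\<lambda>x. LINT y|lborel. norm (case (x, y) of (x, y) \<Rightarrow> f x * g y))"
      using f by simp
    show "AE x in lborel. integrable lborel (\<lambda>y. case (x, y) of (x, y) \<Rightarrow> f x * g y)"
      using g by simp
  qed measurable
  show "integrable lborel (\<lambda>z. f (reindex Inl z) * g (reindex Inr z))"
    unfolding lborel_join[symmetric]
    by (subst integrable_distr_eq) (use int in \<open>auto simp: split_beta'\<close>)
  have "(LINT z|lborel. f (reindex Inl z) * g (reindex Inr z)) = (LINT w|(lborel \<Otimes>\<^sub>M lborel). (case w of (x, y) \<Rightarrow> f x * g y))"
    unfolding lborel_join[symmetric]
    by (subst integral_distr) (auto simp: split_beta')
  also have "\<dots> = (LINT x|lborel. LINT y|lborel. f x * g y)"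
    using lborel_pair.integral_fst'[OF int] by simp
  finally show "(LINT z|lborel. f (reindex Inl z) * g (reindex Inr z)) = (LINT x|lborel. f x) * (LINT y|lborel. g y)"
    by simp
qed

lemma density_join:
  fixes p1 :: "real^'a::finite \<Rightarrow> real" and p2 :: "real^'b::finite \<Rightarrow> real"
  assumes p: "is_density p1" "is_density p2" and eq: "\<And>x y. p (join x y) = p1 x * p2 y"
  shows "density lborel (\<lambda>z. ennreal (p z))
    = distr (density lborel (\<lambda>x. ennreal (p1 x)) \<Otimes>\<^sub>M density lborel (\<lambda>y. ennreal (p2 y))) borel (\<lambda>(x, y). join x y)"
proof -
  note p1 = is_densityD[OF p(1)] and p2 = is_densityD[OF p(2)]
  note [measurable] = p1(5) p2(5)
  interpret M2: finite_measure "density lborel (\<lambda>y. ennreal (p2 y))"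
    by (rule finite_measure_is_density[OF p(2)])
  have pz: "p = (\<lambda>z. p1 (reindex Inl z) * p2 (reindex Inr z))"
    using eq by (metis join_reindex)
  have "density lborel (\<lambda>z. ennreal (p z)) = density (distr (lborel \<Otimes>\<^sub>M lborel) borel (\<lambda>(x, y). join x y)) (\<lambda>z. ennreal (p z))"
    by (simp add: lborel_join)
  also have "\<dots> = distr (density (lborel \<Otimes>\<^sub>M lborel) (\<lambda>w. ennreal (p (case w of (x, y) \<Rightarrow> join x y)))) borel (\<lambda>(x, y). join x y)"
    by (rule density_distr) (auto simp: pz)
  also have "(\<lambda>w. ennreal (p (case w of (x, y) \<Rightarrow> join x y))) = (\<lambda>(x, y). ennreal (p1 x) * ennreal (p2 y))"
    using p1(2) p2(2) by (auto simp: eq ennreal_mult less_imp_le)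
  also have "density (lborel \<Otimes>\<^sub>M lborel) \<dots> = density lborel (\<lambda>x. ennreal (p1 x)) \<Otimes>\<^sub>M density lborel (\<lambda>y. ennreal (p2 y))"
    by (intro pair_measure_density[symmetric] lborel.sigma_finite_measure_axioms M2.sigma_finite_measure_axioms) auto
  finally show ?thesis .
qed

lemma is_density_join:
  fixes p1 :: "real^'a::finite \<Rightarrow> real" and p2 :: "real^'b::finite \<Rightarrow> real"
  assumes p: "is_density p1" "is_density p2" and eq: "\<And>x y. p (join x y) = p1 x * p2 y"
  shows "is_density p"
proof -
  note p1 = is_densityD[OF p(1)] and p2 = is_densityD[OF p(2)]
  have pz: "p = (\<lambda>z. p1 (reindex Inl z) * p2 (reindex Inr z))"
    using eq by (metis join_reindex)
  show ?thesis unfolding is_density_def pz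
    using p1 p2 by (auto intro!: smooth_mult smooth_reindex integral_join_product simp: integral_join_product)
qed

subsection \<open>Separability\<close>

lemma join_potential:
  fixes f :: "real^'a::finite \<Rightarrow> real" and g :: "real^'b::finite \<Rightarrow> real"
  assumes "smooth f" "smooth g"
  defines "F \<equiv> \<lambda>z. f (reindex Inl z) + g (reindex Inr z)"
  shows "smooth F" "grad F z = join (grad f (reindex Inl z)) (grad g (reindex Inr z))"
    "hess F z = block (hess f (reindex Inl z)) (hess g (reindex Inr z))"
proof -
  have sm: "smooth (\<lambda>z. f (reindex Inl z))" "smooth (\<lambda>z. g (reindex Inr z))"
    using assms by (auto intro!: smooth_reindex)
  then show "smooth F" unfolding F_def by (rule smooth_add)
  have l: "(Inl i :: 'a + 'b) \<notin> range Inr" "(Inr j :: 'a + 'b) \<notin> range Inl" for i j by auto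
  have p: "partial (Inl i) F = (\<lambda>z. partial i f (reindex Inl z))" "partial (Inr j) F = (\<lambda>z. partial j g (reindex Inr z))" for i j
    unfolding F_def partial_add_smooth[OF sm] by (simp_all add: partial_reindex l)
  show "grad F z = join (grad f (reindex Inl z)) (grad g (reindex Inr z))"
    by (simp add: vec_eq_iff all_sum grad_def p)
  show "hess F z = block (hess f (reindex Inl z)) (hess g (reindex Inr z))"
    by (simp add: vec_eq_iff all_sum hess_def p partial_reindex l)
qed

lemma diffeo_join:
  fixes S :: "real^'a::finite \<Rightarrow> real^'a" and T :: "real^'b::finite \<Rightarrow> real^'b"
  assumes "diffeo S" "diffeo T"
  shows "diffeo (\<lambda>z. join (S (reindex Inl z)) (T (reindex Inr z)))" (is "diffeo ?F")
proof -
  have sm: "smooth_map (\<lambda>z. join (A (reindex Inl z)) (B (reindex Inr z)))"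
    if "smooth_map A" "smooth_map B" for A :: "real^'a \<Rightarrow> real^'a" and B :: "real^'b \<Rightarrow> real^'b"
    using that by (auto simp: smooth_map_def all_sum intro!: smooth_reindex[where f = "\<lambda>x. A x $ i" for i]
        smooth_reindex[where f = "\<lambda>x. B x $ i" for i])
  have S: "S (inv S x) = x" "inv S (S x) = x" and T: "T (inv T y) = y" "inv T (T y) = y" for x y
    using assms by (simp_all add: diffeo_def bij_is_surj surj_f_inv_f bij_is_inj)
  let ?G = "\<lambda>z. join (inv S (reindex Inl z)) (inv T (reindex Inr z))"
  have FG: "?F (?G z) = z" "?G (?F z) = z" for z by (simp_all add: S T)
  have "bij ?F" by (rule bij_betw_byWitness[where f' = ?G]) (simp_all only: FG subset_UNIV ball_UNIV simp_thms)
  moreover have "inv ?F = ?G" by (rule inv_unique_comp) (simp_all only: fun_eq_iff o_apply id_apply FG simp_thms)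
  ultimately show ?thesis using assms sm by (simp add: diffeo_def)
qed

lemma pushes_join:
  fixes S :: "real^'a::finite \<Rightarrow> real^'a" and T :: "real^'b::finite \<Rightarrow> real^'b"
  assumes S: "pushes S q1 p1" and T: "pushes T q2 p2"
    and d: "is_density p1" "is_density p2" "is_density q1" "is_density q2"
    and p: "\<And>x y. p (join x y) = p1 x * p2 y" and q: "\<And>x y. q (join x y) = q1 x * q2 y"
  shows "pushes (\<lambda>z. join (S (reindex Inl z)) (T (reindex Inr z))) q p" (is "pushes ?F q p")
proof -
  let ?J = "\<lambda>(x, y). join x y"
  have [measurable]: "S \<in> borel_measurable borel" "T \<in> borel_measurable borel"
    using S T by (auto simp: pushes_def)
  define M1 where "M1 = density lborel (\<lambda>x. ennreal (q1 x))"
  define M2 where "M2 = density lborel (\<lambda>x. ennreal (q2 x))"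
  have [measurable_cong]: "sets M1 = sets borel" "sets M2 = sets borel" by (simp_all add: M1_def M2_def)
  have P: "distr M1 borel S = density lborel (\<lambda>x. ennreal (p1 x))" "distr M2 borel T = density lborel (\<lambda>x. ennreal (p2 x))"
    using S T by (simp_all add: pushes_def M1_def M2_def cong: distr_cong)
  interpret N2: finite_measure "distr M2 borel T"
    unfolding P by (rule finite_measure_is_density[OF d(2)])
  have F [measurable]: "?F \<in> borel_measurable borel"
  proof -
    have "(\<lambda>z. ?J (S (reindex Inl z), T (reindex Inr z))) \<in> borel_measurable borel" by measurable
    then show ?thesis by simp
  qed
  have "distr (density lborel (\<lambda>z. ennreal (q z))) borel ?F = distr (distr (M1 \<Otimes>\<^sub>M M2) borel ?J) borel ?F"
    by (simp add: density_join[OF d(3,4) q] M1_def M2_def)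
  also have "\<dots> = distr (M1 \<Otimes>\<^sub>M M2) borel (?F \<circ> ?J)"
    by (rule distr_distr) auto
  \<comment> \<open>On pairs the map acts on each factor separately, so the image of the product
    measure is the product of the images.\<close>
  also have "?F \<circ> ?J = ?J \<circ> (\<lambda>(x, y). (S x, T y))" by (auto simp: fun_eq_iff)
  also have "distr (M1 \<Otimes>\<^sub>M M2) borel \<dots> = distr (distr (M1 \<Otimes>\<^sub>M M2) (borel \<Otimes>\<^sub>M borel) (\<lambda>(x, y). (S x, T y))) borel ?J"
    by (rule distr_distr[symmetric]) auto
  also have "distr (M1 \<Otimes>\<^sub>M M2) (borel \<Otimes>\<^sub>M borel) (\<lambda>(x, y). (S x, T y)) = distr M1 borel S \<Otimes>\<^sub>M distr M2 borel T"
    by (intro pair_measure_distr[symmetric] N2.sigma_finite_measure_axioms) auto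
  also have "distr \<dots> borel ?J = density lborel (\<lambda>z. ennreal (p z))"
    by (simp add: P density_join[OF d(1,2) p])
  finally show ?thesis using F by (simp add: pushes_def cong: distr_cong)
qed

text \<open>Separability assumes admissibility of the factors only. Full admissibility of the summed
  potential is what guarantees that the divergence of the product pair refers to an actual transport
  map.\<close>

lemma admissible_pot_join:
  fixes p1 q1 f :: "real^'a::finite \<Rightarrow> real" and p2 q2 g :: "real^'b::finite \<Rightarrow> real"
  assumes f: "admissible_pot p1 q1 f" and g: "admissible_pot p2 q2 g"
    and d: "is_density p1" "is_density p2" "is_density q1" "is_density q2"
    and p: "\<And>x y. p (join x y) = p1 x * p2 y" and q: "\<And>x y. q (join x y) = q1 x * q2 y"
  shows "admissible_pot p q (\<lambda>z. f (reindex Inl z) + g (reindex Inr z))" (is "admissible_pot p q ?F")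
proof -
  note F = admissible_potD[OF f] and G = admissible_potD[OF g]
  note FG = join_potential[OF F(1) G(1)]
  have grad: "grad ?F = (\<lambda>z. join (grad f (reindex Inl z)) (grad g (reindex Inr z)))" using FG(2) by (rule ext)
  have det: "det (hess ?F z) = det (hess f (reindex Inl z)) * det (hess g (reindex Inr z))" for z
    unfolding FG by (rule det_block) (simp_all add: transpose_hess F G)
  have ln: "ln (det (hess ?F z)) = ln (det (hess f (reindex Inl z))) + ln (det (hess g (reindex Inr z)))" for z
    unfolding det using posdef_det_pos[OF F(9)] posdef_det_pos[OF G(9)] by (simp add: ln_mult less_imp_neq[symmetric])
  have lap: "lap ?F z = lap f (reindex Inl z) + lap g (reindex Inr z)" for z
    by (simp add: lap_def FG trace_block)
  have qz: "q z = q1 (reindex Inl z) * q2 (reindex Inr z)" for z using q by (metis join_reindex)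
  have pos: "v \<bullet> (hess ?F z *v v) > 0" if "v \<noteq> 0" for v z
  proof -
    have "v \<bullet> (hess ?F z *v v) = reindex Inl v \<bullet> (hess f (reindex Inl z) *v reindex Inl v)
        + reindex Inr v \<bullet> (hess g (reindex Inr z) *v reindex Inr v)"
      by (simp add: FG block_mult_vec inner_join)
    moreover have "reindex Inl v \<noteq> 0 \<or> reindex Inr v \<noteq> 0"
      using that by (auto simp: vec_eq_iff all_sum)
    moreover have "x \<noteq> 0 \<Longrightarrow> x \<bullet> (hess f y *v x) > 0" "u \<noteq> 0 \<Longrightarrow> u \<bullet> (hess g w *v u) > 0" for x y u w
      using F(2) G(2) by auto
    ultimately show ?thesis
      by (cases "reindex Inl v = 0"; cases "reindex Inr v = 0") (auto intro: add_pos_pos)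
  qed
  have "v \<bullet> (hess ?F z *v v) \<ge> 0" for v z using pos[of v z] by (cases "v = 0") simp_all
  then have "convex_on UNIV ?F" by (rule convex_on_UNIV_if_hess[OF FG(1)])
  moreover have "pushes (grad ?F) q p" unfolding grad by (rule pushes_join[OF F(3) G(3) d p q])
  moreover have "diffeo (grad ?F)" unfolding grad by (rule diffeo_join[OF F(5) G(5)])
  moreover have "p (grad ?F z) * det (hess ?F z) = q z" for z
    by (simp add: grad p det qz F(6)[symmetric] G(6)[symmetric])
  moreover have "integrable lborel (\<lambda>z. q z * lap ?F z)"
  proof -
    have "(\<lambda>z. q z * lap ?F z) = (\<lambda>z. (q1 (reindex Inl z) * lap f (reindex Inl z)) * q2 (reindex Inr z)
        + q1 (reindex Inl z) * (q2 (reindex Inr z) * lap g (reindex Inr z)))"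
      by (simp add: lap qz algebra_simps)
    then show ?thesis using F(7) G(7) is_densityD(3)[OF d(3)] is_densityD(3)[OF d(4)]
      by (auto intro!: Bochner_Integration.integrable_add
          integral_join_product(1)[where f = "\<lambda>x. q1 x * lap f x"] integral_join_product(1)[where g = "\<lambda>x. q2 x * lap g x"])
  qed
  moreover have "integrable lborel (\<lambda>z. q z * ln (det (hess ?F z)))"
  proof -
    have "(\<lambda>z. q z * ln (det (hess ?F z))) = (\<lambda>z. (q1 (reindex Inl z) * ln (det (hess f (reindex Inl z)))) * q2 (reindex Inr z)
        + q1 (reindex Inl z) * (q2 (reindex Inr z) * ln (det (hess g (reindex Inr z)))))"
      by (simp only: ln qz) (simp add: algebra_simps)
    then show ?thesis using F(8) G(8) is_densityD(3)[OF d(3)] is_densityD(3)[OF d(4)]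
      by (auto intro!: Bochner_Integration.integrable_add
          integral_join_product(1)[where f = "\<lambda>x. q1 x * ln (det (hess f x))"]
          integral_join_product(1)[where g = "\<lambda>x. q2 x * ln (det (hess g x))"])
  qed
  ultimately show ?thesis
    using FG(1) pos by (simp add: admissible_pot_def brenier_potential_def)
qed

theorem D_TKL_join:
  fixes p1 q1 :: "real^'a::finite \<Rightarrow> real" and p2 q2 :: "real^'b::finite \<Rightarrow> real"
  assumes adm: "admissible p1 q1" "admissible p2 q2"
    and p: "\<And>x y. p (join x y) = p1 x * p2 y" and q: "\<And>x y. q (join x y) = q1 x * q2 y"
  shows "D_TKL p q = D_TKL p1 q1 + D_TKL p2 q2"
proof -
  from adm obtain f g where d: "is_density p1" "is_density p2" "is_density q1" "is_density q2"
    and f: "admissible_pot p1 q1 f" and g: "admissible_pot p2 q2 g" by (auto simp: admissible_def)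
  let ?F = "\<lambda>z. f (reindex Inl z) + g (reindex Inr z)"
  note F = admissible_potD[OF f] and G = admissible_potD[OF g]
  note FG = join_potential[OF F(1) G(1)]
  let ?I1 = "\<lambda>x. (lap f x - ln (det (hess f x)) - real CARD('a)) * q1 x"
  let ?I2 = "\<lambda>x. (lap g x - ln (det (hess g x)) - real CARD('b)) * q2 x"
  note J1 = integral_join_product[OF integrable_D_TKL[OF d(3) f] is_densityD(3)[OF d(4)]]
  note J2 = integral_join_product[OF is_densityD(3)[OF d(3)] integrable_D_TKL[OF d(4) g]]
  have ln: "ln (det (hess ?F z)) = ln (det (hess f (reindex Inl z))) + ln (det (hess g (reindex Inr z)))" for z
    unfolding FG det_block[OF transpose_hess[OF F(1)] transpose_hess[OF G(1)]]
    using posdef_det_pos[OF F(9)] posdef_det_pos[OF G(9)] by (simp add: ln_mult less_imp_neq[symmetric])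
  have lap: "lap ?F z = lap f (reindex Inl z) + lap g (reindex Inr z)" for z
    by (simp add: lap_def FG trace_block)
  have qz: "q z = q1 (reindex Inl z) * q2 (reindex Inr z)" for z using q by (metis join_reindex)
  have "D_TKL p q = (LINT z|lborel. (lap ?F z - ln (det (hess ?F z)) - real CARD('a + 'b)) * q z)"
    by (rule D_TKL_admissible_pot[OF is_density_join[OF d(3,4) q] admissible_pot_join[OF f g d p q]])
  also have "\<dots> = (LINT z|lborel. ?I1 (reindex Inl z) * q2 (reindex Inr z) + q1 (reindex Inl z) * ?I2 (reindex Inr z))"
    by (intro Bochner_Integration.integral_cong refl, unfold ln lap qz) (simp add: algebra_simps)
  \<comment> \<open>In each summand the other factor is a density and integrates to 1.\<close>
  also have "\<dots> = D_TKL p1 q1 + D_TKL p2 q2"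
    using J1 J2 is_densityD(4)[OF d(3)] is_densityD(4)[OF d(4)]
    by (simp add: D_TKL_admissible_pot[OF d(3) f] D_TKL_admissible_pot[OF d(4) g])
  finally show ?thesis .
qed

subsection \<open>Change of variables for gradient maps\<close>

text \<open>The library change of variables theorem asks for a well-ordered index type; this copy of a
  finite type carries such an order.\<close>
typedef 'a ordered_copy = "UNIV :: 'a set" by simp

lemma bij_Rep_ordered_copy: "bij Rep_ordered_copy"
  by (rule bij_betw_byWitness[where f' = Abs_ordered_copy])
    (auto simp: Rep_ordered_copy_inverse Abs_ordered_copy_inverse)

instance ordered_copy :: (finite) finite
proof
  have "(UNIV :: 'a ordered_copy set) = range Abs_ordered_copy"
    by (metis Rep_ordered_copy_inverse surj_def)
  then show "finite (UNIV :: 'a ordered_copy set)" by (metis finite finite_imageI)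
qed

instantiation ordered_copy :: (countable) wellorder
begin

definition less_eq_ordered_copy :: "'a ordered_copy \<Rightarrow> 'a ordered_copy \<Rightarrow> bool" where
  "x \<le> y \<longleftrightarrow> to_nat (Rep_ordered_copy x) \<le> to_nat (Rep_ordered_copy y)"

definition less_ordered_copy :: "'a ordered_copy \<Rightarrow> 'a ordered_copy \<Rightarrow> bool" where
  "x < y \<longleftrightarrow> to_nat (Rep_ordered_copy x) < to_nat (Rep_ordered_copy y)"

instance
proof
  fix P :: "'a ordered_copy \<Rightarrow> bool" and a
  assume step: "\<And>x. (\<And>y. y < x \<Longrightarrow> P y) \<Longrightarrow> P x"
  show "P a"
  proof (induction "to_nat (Rep_ordered_copy a)" arbitrary: a rule: less_induct)
    case less
    show ?case by (rule step, rule less) (simp add: less_ordered_copy_def)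
  qed
qed (auto simp: less_eq_ordered_copy_def less_ordered_copy_def Rep_ordered_copy_inject)

end

lemma change_of_variables_density:
  fixes F G :: "real^'m::{finite,wellorder} \<Rightarrow> real^'m::_"
  assumes F: "\<And>x. (F has_derivative F' x) (at x)" and G: "\<And>y. (G has_derivative G' y) (at y)"
    and GF: "\<And>x. G (F x) = x" and FG: "\<And>y. F (G y) = y" and id: "\<And>y. G' y \<circ> F' (G y) = id"
    and [measurable]: "p \<in> borel_measurable borel" "(\<lambda>x. det (matrix (F' x))) \<in> borel_measurable borel"
    and p: "\<And>x. p x \<ge> 0" "integrable lborel p"
  shows "distr (density lborel (\<lambda>x. ennreal (\<bar>det (matrix (F' x))\<bar> * p (F x)))) borel F = density lborel (\<lambda>x. ennreal (p x))"
proof (rule measure_eqI)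
  have "continuous_on UNIV F" by (intro continuous_at_imp_continuous_on ballI has_derivative_continuous[OF F])
  then have [measurable]: "F \<in> borel_measurable borel" by (rule borel_measurable_continuous_onI)
  fix B assume "B \<in> sets (distr (density lborel (\<lambda>x. ennreal (\<bar>det (matrix (F' x))\<bar> * p (F x)))) borel F)"
  then have [measurable]: "B \<in> sets borel" by simp
  \<comment> \<open>Applying the integral formula to \<open>p\<close> cut off to an arbitrary Borel
    set \<open>B\<close> turns it into an equality of measures.\<close>
  define f where "f = (\<lambda>y. p y * indicator B y)"
  have [measurable]: "f \<in> borel_measurable borel" unfolding f_def by measurable
  have f0: "f y \<ge> 0" for y using p by (simp add: f_def)
  have "integrable lborel f" unfolding f_def using p(2) by (rule integrable_real_mult_indicator[rotated]) simp
  then have hf: "(f has_integral (LINT y|lborel. f y)) UNIV" by (rule has_integral_integral_lborel)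
  then have "((\<lambda>x. \<bar>det (matrix (F' x))\<bar> * f (F x)) has_integral (LINT y|lborel. f y)) UNIV"
    by (subst cov_invertible_nonneg_eq[where T = UNIV and h = G and h' = G'])
      (auto simp: GF FG f0 id intro: F G)
  then have 1: "(\<integral>\<^sup>+x. ennreal (\<bar>det (matrix (F' x))\<bar> * f (F x)) \<partial>lborel) = ennreal (LINT y|lborel. f y)"
    by (intro nn_integral_has_integral_lborel) (auto simp: f0)
  have 2: "(\<integral>\<^sup>+y. ennreal (f y) \<partial>lborel) = ennreal (LINT y|lborel. f y)"
    using hf f0 by (intro nn_integral_has_integral_lborel) auto
  have "emeasure (distr (density lborel (\<lambda>x. ennreal (\<bar>det (matrix (F' x))\<bar> * p (F x)))) borel F) B
      = (\<integral>\<^sup>+x. ennreal (\<bar>det (matrix (F' x))\<bar> * p (F x)) * indicator (F -` B) x \<partial>lborel)"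
    using measurable_sets[OF \<open>F \<in> borel_measurable borel\<close> \<open>B \<in> sets borel\<close>]
    by (subst emeasure_distr) (auto simp: emeasure_density)
  also have "\<dots> = (\<integral>\<^sup>+x. ennreal (\<bar>det (matrix (F' x))\<bar> * f (F x)) \<partial>lborel)"
    by (intro nn_integral_cong) (simp add: f_def indicator_def)
  also have "\<dots> = (\<integral>\<^sup>+y. ennreal (p y) * indicator B y \<partial>lborel)"
    unfolding 1 2[symmetric] by (intro nn_integral_cong) (simp add: f_def indicator_def)
  also have "\<dots> = emeasure (density lborel (\<lambda>x. ennreal (p x))) B"
    by (simp add: emeasure_density)
  finally show "emeasure (distr (density lborel (\<lambda>x. ennreal (\<bar>det (matrix (F' x))\<bar> * p (F x)))) borel F) B
      = emeasure (density lborel (\<lambda>x. ennreal (p x))) B" .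
qed simp

lemma lborel_reindex:
  fixes h :: "'a::finite \<Rightarrow> 'b::finite"
  assumes "bij h"
  shows "distr lborel borel (reindex h) = lborel"
proof (rule lborel_eqI[symmetric])
  define k where "k = inv h"
  have hk: "h (k b) = b" "k (h a) = a" for a b
    using assms by (simp_all add: k_def bij_is_surj surj_f_inv_f bij_is_inj)
  fix l u :: "real^'a" assume "\<And>b. b \<in> Basis \<Longrightarrow> l \<bullet> b \<le> u \<bullet> b"
  then have lu: "l $ i \<le> u $ i" for i
    using inner_axis[of l i 1] inner_axis[of u i 1] by (metis Basis_vec_eq rangeI inner_real_def mult.right_neutral)
  have "reindex h -` box l u = box (reindex k l) (reindex k u)"
    by (auto simp: box_def Basis_vec_eq inner_axis) (metis hk)+
  then have "emeasure (distr lborel borel (reindex h)) (box l u) = emeasure lborel (box (reindex k l) (reindex k u))"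
    by (subst emeasure_distr) auto
  also have "\<dots> = ennreal (\<Prod>i\<in>UNIV. u $ k i - l $ k i)"
    using lu by (subst emeasure_lborel_box_vec) auto
  also have "(\<Prod>i\<in>UNIV. u $ k i - l $ k i) = (\<Prod>i\<in>UNIV. u $ i - l $ i)"
    by (rule prod.reindex_bij_betw) (simp add: k_def assms bij_imp_bij_inv)
  also have "\<dots> = (\<Prod>b\<in>Basis. (u - l) \<bullet> b)" by (simp add: prod_Basis_vec inner_axis)
  finally show "emeasure (distr lborel borel (reindex h)) (box l u) = (\<Prod>b\<in>Basis. (u - l) \<bullet> b)" .
qed simp

text \<open>Simultaneous relabelling of rows and columns respects products, transposes and the
  identity, so it carries a diagonalisation to a diagonalisation with permuted eigenvalues.\<close>

lemma det_reindex:
  fixes A :: "real^'b::finite^'b" and h :: "'a::finite \<Rightarrow> 'b"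
  assumes h: "bij h" and "transpose A = A"
  shows "det (\<chi> i j. A $ h i $ h j) = det A"
proof -
  define r where "r = (\<lambda>A :: real^'b^'b. (\<chi> i j. A $ h i $ h j) :: real^'a^'a)"
  obtain Q d where Q: "orthogonal_matrix Q" "A = Q ** diag d ** transpose Q"
    using symmetric_matrix_diagonalization[OF assms(2)] by blast
  have mult: "r (A ** B) = r A ** r B" for A B
    by (simp add: r_def matrix_matrix_mult_def vec_eq_iff) (intro allI sum.reindex_bij_betw[OF h, symmetric])
  have tr: "r (transpose A) = transpose (r A)" for A by (simp add: r_def transpose_def vec_eq_iff)
  have one: "r (mat 1) = mat 1" using h by (simp add: r_def mat_def vec_eq_iff bij_is_inj inj_eq)
  have dg: "r (diag d) = diag (d \<circ> h)" using h by (simp add: r_def diag_def vec_eq_iff bij_is_inj inj_eq)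
  have "orthogonal_matrix (r Q)"
    using Q(1) by (simp add: orthogonal_matrix_def tr[symmetric] mult[symmetric] one)
  then have "det (r A) = (\<Prod>i\<in>UNIV. d (h i))"
    by (simp add: Q(2) mult tr dg det_conj det_diag)
  also have "\<dots> = det A"
    using Q by (simp add: det_conj det_diag prod.reindex_bij_betw[OF h])
  finally show ?thesis by (simp add: r_def)
qed

text \<open>The ordered copy is removed again: \<open>F\<close> is conjugated by the
  measure-preserving relabelling \<open>R\<close>, and symmetry of \<open>A\<close> ensures that the
  Jacobian determinant is unchanged.\<close>

lemma change_of_variables_symmetric:
  fixes F G :: "real^'n::finite \<Rightarrow> real^'n"
  assumes F: "\<And>x. (F has_derivative (\<lambda>h. A x *v h)) (at x)" and G: "\<And>y. (G has_derivative G' y) (at y)"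
    and GF: "\<And>x. G (F x) = x" and FG: "\<And>y. F (G y) = y" and id: "\<And>y h. G' y (A (G y) *v h) = h"
    and sym: "\<And>x. transpose (A x) = A x" and [measurable]: "(\<lambda>x. det (A x)) \<in> borel_measurable borel"
    and p: "\<And>x. p x \<ge> 0" "integrable lborel p"
  shows "distr (density lborel (\<lambda>x. ennreal (\<bar>det (A x)\<bar> * p (F x)))) borel F = density lborel (\<lambda>x. ennreal (p x))"
proof -
  define R :: "real^'n \<Rightarrow> real^'n ordered_copy" where "R = reindex Rep_ordered_copy"
  define R' :: "real^'n ordered_copy \<Rightarrow> real^'n" where "R' = reindex Abs_ordered_copy"
  have RR [simp]: "R (R' x) = x" "R' (R y) = y" for x y
    by (simp_all add: R_def R'_def vec_eq_iff Rep_ordered_copy_inverse Abs_ordered_copy_inverse)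
  have lin: "linear R" "linear R'" by (simp_all add: R_def R'_def linear_reindex)
  have [measurable]: "R \<in> borel_measurable borel" "R' \<in> borel_measurable borel" by (simp_all add: R_def R'_def)
  have [measurable]: "p \<in> borel_measurable borel" using borel_measurable_integrable[OF p(2)] by simp
  have contF: "continuous_on UNIV F" by (intro continuous_at_imp_continuous_on ballI has_derivative_continuous[OF F])
  then have [measurable]: "F \<in> borel_measurable borel" by (rule borel_measurable_continuous_onI)
  have lb: "distr lborel borel R = lborel" unfolding R_def by (rule lborel_reindex[OF bij_Rep_ordered_copy])
  have transport: "density lborel (\<lambda>x. ennreal (k (R' x))) = distr (density lborel (\<lambda>x. ennreal (k x))) borel R"
    if [measurable]: "k \<in> borel_measurable borel" for k
  proof -
    have "density (distr lborel borel R) (\<lambda>x. ennreal (k (R' x))) = distr (density lborel (\<lambda>x. ennreal (k (R' (R x))))) borel R"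
      by (rule density_distr) auto
    then show ?thesis by (simp add: lb)
  qed
  define F1 where "F1 = (\<lambda>x. R (F (R' x)))"
  define F1' where "F1' = (\<lambda>x h. R (A (R' x) *v R' h))"
  have "matrix (F1' x) = (\<chi> i j. A (R' x) $ Rep_ordered_copy i $ Rep_ordered_copy j)" for x
  proof -
    have ax: "R' (axis j 1) = axis (Rep_ordered_copy j) 1" for j
      by (auto simp: R'_def vec_eq_iff axis_def Abs_ordered_copy_inverse Rep_ordered_copy_inverse)
    show ?thesis
      by (subst vec_eq_iff) (simp add: matrix_def F1'_def R_def matrix_vector_mul_component inner_axis ax)
  qed
  then have det: "det (matrix (F1' x)) = det (A (R' x))" for x
    using det_reindex[OF bij_Rep_ordered_copy sym] by simp
  let ?k = "\<lambda>x. \<bar>det (A x)\<bar> * p (F x)"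
  have "integrable lborel (\<lambda>x. p (R' x))"
    unfolding lb[symmetric] by (subst integrable_distr_eq) (use p in auto)
  moreover have "(F1 has_derivative F1' x) (at x)" for x
    unfolding F1_def F1'_def
    by (rule has_derivative_compose[OF has_derivative_compose[OF linear_imp_has_derivative[OF lin(2)] F] linear_imp_has_derivative[OF lin(1)]])
  moreover have "((\<lambda>y. R (G (R' y))) has_derivative (\<lambda>h. R (G' (R' y) (R' h)))) (at y)" for y
    by (rule has_derivative_compose[OF has_derivative_compose[OF linear_imp_has_derivative[OF lin(2)] G] linear_imp_has_derivative[OF lin(1)]])
  ultimately have "distr (density lborel (\<lambda>x. ennreal (\<bar>det (matrix (F1' x))\<bar> * p (R' (F1 x))))) borel F1
      = density lborel (\<lambda>x. ennreal (p (R' x)))"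
    by (intro change_of_variables_density[where G = "\<lambda>y. R (G (R' y))" and G' = "\<lambda>y h. R (G' (R' y) (R' h))"])
      (auto simp: F1_def F1'_def GF FG id p det[unfolded F1'_def] fun_eq_iff)
  moreover have "(\<lambda>x. \<bar>det (matrix (F1' x))\<bar> * p (R' (F1 x))) = (\<lambda>x. ?k (R' x))"
    by (simp add: det F1_def)
  ultimately have "distr (density lborel (\<lambda>x. ennreal (?k (R' x)))) borel F1 = density lborel (\<lambda>x. ennreal (p (R' x)))"
    by metis
  then have "distr (distr (density lborel (\<lambda>x. ennreal (?k x))) borel R) borel F1 = distr (density lborel (\<lambda>x. ennreal (p x))) borel R"
    by (simp only: transport[of ?k, simplified] transport[of p, simplified])
  then have "distr (distr (distr (density lborel (\<lambda>x. ennreal (?k x))) borel R) borel F1) borel R'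
      = distr (distr (density lborel (\<lambda>x. ennreal (p x))) borel R) borel R'"
    by simp
  moreover have [measurable]: "F1 \<in> borel_measurable borel" unfolding F1_def by measurable
  ultimately have "distr (density lborel (\<lambda>x. ennreal (?k x))) borel F = distr (density lborel (\<lambda>x. ennreal (p x))) borel (\<lambda>x. x)"
    by (simp add: distr_distr o_def F1_def)
  then show ?thesis by (simp add: distr_id2)
qed

text \<open>Both \<open>q\<close> and \<open>\<bar>det (A x)\<bar> * p (F x)\<close> are densities
  of measures that \<open>F\<close> carries to \<open>p\<close>. Applying the inverse
  \<open>G\<close> shows the measures equal, so the densities agree almost everywhere and, by
  continuity, everywhere.\<close>

lemma pushes_imp_jacobian_equation:
  fixes F G :: "real^'n::finite \<Rightarrow> real^'n"
  assumes F: "\<And>x. (F has_derivative (\<lambda>h. A x *v h)) (at x)" and G: "\<And>y. (G has_derivative G' y) (at y)"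
    and GF: "\<And>x. G (F x) = x" and FG: "\<And>y. F (G y) = y" and id: "\<And>y h. G' y (A (G y) *v h) = h"
    and sym: "\<And>x. transpose (A x) = A x" and det: "continuous_on UNIV (\<lambda>x. det (A x))" "\<And>x. det (A x) > 0"
    and p: "is_density p" and q: "is_density q" and push: "pushes F q p"
  shows "p (F x) * det (A x) = q x"
proof -
  note pd = is_densityD[OF p] and qd = is_densityD[OF q]
  have contF: "continuous_on UNIV F" by (intro continuous_at_imp_continuous_on ballI has_derivative_continuous[OF F])
  have contG: "continuous_on UNIV G" by (intro continuous_at_imp_continuous_on ballI has_derivative_continuous[OF G])
  have contpF: "continuous_on UNIV (\<lambda>x. p (F x))" by (rule continuous_on_compose2[OF pd(6) contF]) auto
  note [measurable] = borel_measurable_continuous_onI[OF contF] borel_measurable_continuous_onI[OF contG]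
    borel_measurable_continuous_onI[OF det(1)] pd(5) qd(5)
  let ?k = "\<lambda>x. \<bar>det (A x)\<bar> * p (F x)"
  have "distr (density lborel (\<lambda>x. ennreal (?k x))) borel F = density lborel (\<lambda>x. ennreal (p x))"
    by (rule change_of_variables_symmetric[OF F G GF FG id sym]) (use pd in \<open>auto intro: less_imp_le\<close>)
  also have "\<dots> = distr (density lborel (\<lambda>x. ennreal (q x))) borel F"
    using push by (simp add: pushes_def cong: distr_cong)
  finally have "distr (distr (density lborel (\<lambda>x. ennreal (?k x))) borel F) borel G
      = distr (distr (density lborel (\<lambda>x. ennreal (q x))) borel F) borel G" by simp
  then have "density lborel (\<lambda>x. ennreal (?k x)) = density lborel (\<lambda>x. ennreal (q x))"
    by (simp add: distr_distr o_def GF distr_id2)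
  then have "AE x in lborel. ennreal (?k x) = ennreal (q x)"
    by (intro sigma_finite_measure.density_unique[OF lborel.sigma_finite_measure_axioms]) auto
  then have "AE x in lborel. p (F x) * det (A x) = q x"
    by eventually_elim (use pd(2) qd(2) det(2) in \<open>simp add: ennreal_inj less_imp_le mult.commute\<close>)
  moreover have "continuous_on UNIV (\<lambda>x. p (F x) * det (A x))" by (intro continuous_intros contpF det)
  ultimately show ?thesis using AE_lborel_continuous_eq[of "\<lambda>x. p (F x) * det (A x)" q] qd(6) by blast
qed

subsection \<open>Smoothness of inverse gradient maps\<close>

text \<open>The functions \<open>h \<circ> G\<close> with \<open>h\<close> smooth are closed under partial derivatives because the entries of
  the inverse Jacobian are, by Cramer's rule, smooth functions evaluated at \<open>G\<close>.\<close>
lemma inverse_grad_smooth: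
  fixes Psi :: "real^'n::finite \<Rightarrow> real"
  assumes Psi: "smooth Psi" "\<And>x. posdef (hess Psi x)"
    and GF: "\<And>x. G (grad Psi x) = x" and FG: "\<And>y. grad Psi (G y) = y" and contG: "continuous_on UNIV G"
  shows "(G has_derivative (\<lambda>h. matrix_inv (hess Psi (G y)) *v h)) (at y)"
    and "matrix_inv (hess Psi x) *v (hess Psi x *v h) = h"
    and "smooth_map G"
proof -
  let ?A = "hess Psi"
  have nz: "det (?A x) \<noteq> 0" for x using posdef_det_pos[OF Psi(2), of x] by simp
  then have inv: "?A x ** matrix_inv (?A x) = mat 1" "matrix_inv (?A x) ** ?A x = mat 1" for x
    using someI_ex[of "\<lambda>B. ?A x ** B = mat 1 \<and> B ** ?A x = mat 1"] invertible_det_nz[of "?A x"]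
    by (auto simp: matrix_inv_def invertible_def)
  show left: "matrix_inv (?A x) *v (?A x *v h) = h" for x h
    by (simp add: matrix_vector_mul_assoc inv)
  show G: "(G has_derivative (\<lambda>h. matrix_inv (?A (G y)) *v h)) (at y)" for y
  proof (rule has_derivative_inverse_basic[where T = UNIV, OF grad_has_derivative[OF Psi(1)]])
    show "continuous (at y) G" using contG by (simp add: continuous_on_eq_continuous_at)
    show "(*v) (matrix_inv (?A (G y))) \<circ> (*v) (?A (G y)) = id" by (simp add: fun_eq_iff left)
  qed (auto simp: FG)
  define c where "c = (\<lambda>i j x. det (\<chi> k l. if l = i then axis j 1 $ k else ?A x $ k $ l) * inverse (det (?A x)))"
  have c: "smooth (c i j)" for i j
    unfolding c_def
  proof (intro smooth_mult smooth_inverse smooth_det nz)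
    fix k l
    show "smooth (\<lambda>x. (\<chi> k l. if l = i then axis j 1 $ k else ?A x $ k $ l) $ k $ l)"
      by (cases "l = i") (simp_all add: smooth_const hess_component_smooth Psi)
  qed (simp add: hess_component_smooth Psi)
  have entry: "(matrix_inv (?A x) *v axis j 1) $ i = c i j x" for i j x
  proof -
    have "?A x *v (matrix_inv (?A x) *v axis j 1) = axis j 1"
      by (simp add: matrix_vector_mul_assoc inv)
    then have *: "matrix_inv (?A x) *v axis j 1 = (\<chi> i. det (\<chi> k l. if l = i then axis j 1 $ k else ?A x $ k $ l) / det (?A x))"
      using cramer[OF nz] by blast
    show ?thesis unfolding * by (simp add: c_def divide_inverse)
  qed
  have compose: "smooth (\<lambda>y. h (G y))" if "smooth h" for h
  proof (rule smooth_coinduct[of "\<lambda>g. \<exists>h. smooth h \<and> g = (\<lambda>y. h (G y))"])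
    show "\<exists>h'. smooth h' \<and> (\<lambda>y. h (G y)) = (\<lambda>y. h' (G y))" using that by blast
  next
    fix g x assume "\<exists>h. smooth h \<and> g = (\<lambda>y. h (G y))"
    then obtain h where h: "smooth h" "g = (\<lambda>y. h (G y))" by blast
    show "g differentiable (at x)"
      using has_derivative_compose[OF G smooth_has_derivative[OF h(1)]] unfolding h(2) differentiable_def by blast
  next
    fix g j assume "\<exists>h. smooth h \<and> g = (\<lambda>y. h (G y))"
    then obtain h where h: "smooth h" "g = (\<lambda>y. h (G y))" by blast
    have "partial j g y = (\<Sum>i\<in>UNIV. c i j (G y) * partial i h (G y))" for y
      unfolding h(2) partial_eqI[OF has_derivative_compose[OF G smooth_has_derivative[OF h(1)]]]
      by (simp add: inner_grad entry)
    then have "partial j g = (\<lambda>y. (\<lambda>x. \<Sum>i\<in>UNIV. c i j x * partial i h x) (G y))" by (intro ext)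
    moreover have "smooth (\<lambda>x. \<Sum>i\<in>UNIV. c i j x * partial i h x)"
      by (intro smooth_sum smooth_mult c smooth_partial h) auto
    ultimately show "\<exists>h. smooth h \<and> partial j g = (\<lambda>y. h (G y))" by blast
  qed
  show "smooth_map G" unfolding smooth_map_def using compose[OF smooth_coord] by simp
qed

subsection \<open>Perturbations of the identity\<close>

lemma partial_eq_0_outside:
  fixes f :: "real^'n::finite \<Rightarrow> real"
  assumes "open U" "x \<in> U" "\<And>x. x \<in> U \<Longrightarrow> f x = 0"
  shows "partial i f x = 0"
proof -
  have "(f has_derivative (\<lambda>h. 0)) (at x)"
    by (rule has_derivative_transform_within_open[OF has_derivative_const[of 0] assms(1,2)]) (simp add: assms(3))
  then show ?thesis by (rule partial_eqI)
qed

lemma compact_support_hess_bounded: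
  fixes Phi :: "real^'n::finite \<Rightarrow> real"
  assumes "smooth Phi" "bounded {x. Phi x \<noteq> 0}"
  obtains K where "K > 0" "\<And>x v. norm (hess Phi x *v v) \<le> K * norm v"
proof -
  obtain r where r: "\<And>x. Phi x \<noteq> 0 \<Longrightarrow> norm x \<le> r" using assms(2) by (auto simp: bounded_iff)
  \<comment> \<open>An open set on which \<open>Phi\<close> vanishes, so that its first and second
    partials vanish there too; the rest is compact.\<close>
  let ?U = "- cball (0 :: real^'n) r"
  have U: "open ?U" by (simp add: open_Compl)
  have "Phi x = 0" if "x \<in> ?U" for x using r that by force
  then have "partial i Phi x = 0" if "x \<in> ?U" for i x using partial_eq_0_outside[OF U that] by blast
  then have out: "hess Phi x $ i $ j = 0" if "x \<in> ?U" for i j x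
    using partial_eq_0_outside[OF U that, of "partial i Phi" j] by (simp add: hess_def)
  have "\<exists>C. \<forall>x\<in>cball 0 r. \<bar>hess Phi x $ i $ j\<bar> \<le> C" for i j
  proof -
    have "compact ((\<lambda>x. hess Phi x $ i $ j) ` cball 0 r)"
      by (intro compact_continuous_image smooth_imp_continuous_on hess_component_smooth assms) auto
    then show ?thesis using compact_imp_bounded by (fastforce simp: bounded_iff)
  qed
  then obtain C where C: "\<And>i j x. x \<in> cball 0 r \<Longrightarrow> \<bar>hess Phi x $ i $ j\<bar> \<le> C i j" by metis
  define B where "B = (\<Sum>i\<in>UNIV. \<Sum>j\<in>UNIV. \<bar>C i j\<bar>)"
  have CB: "\<bar>C i j\<bar> \<le> B" for i j
  proof -
    have "\<bar>C i j\<bar> \<le> (\<Sum>j\<in>UNIV. \<bar>C i j\<bar>)" by (rule member_le_sum) auto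
    also have "\<dots> \<le> B" unfolding B_def by (rule member_le_sum) (auto intro: sum_nonneg)
    finally show ?thesis .
  qed
  have B0: "B \<ge> 0" unfolding B_def by (intro sum_nonneg) auto
  have "\<bar>hess Phi x $ i $ j\<bar> \<le> B" for x i j
    using C[of x i j] CB[of i j] out[of x i j] B0 by (cases "x \<in> cball 0 r") auto
  then have "onorm ((*v) (hess Phi x)) \<le> real CARD('n) * real CARD('n) * B" for x
    by (rule onorm_le_matrix_component)
  then have "norm (hess Phi x *v v) \<le> (real CARD('n) * real CARD('n) * B) * norm v" for x v
    using onorm[OF matrix_vector_mul_bounded_linear, of "hess Phi x" v] mult_right_mono[of "onorm ((*v) (hess Phi x))" _ "norm v"]
    by (meson norm_ge_zero order_trans)
  \<comment> \<open>Adding 1 makes the constant strictly positive even if \<open>B = 0\<close>; the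
    smallness condition on \<open>e\<close> later divides by it.\<close>
  then have "norm (hess Phi x *v v) \<le> (real CARD('n) * real CARD('n) * B + 1) * norm v" for x v
    by (smt (verit) mult_right_mono norm_ge_zero)
  then show ?thesis using that[of "real CARD('n) * real CARD('n) * B + 1"] B0 by (simp add: add_nonneg_pos)
qed

lemma integrable_density_mult_bounded:
  fixes q f :: "real^'n::finite \<Rightarrow> real"
  assumes "is_density q" "continuous_on UNIV f" "\<And>x. \<bar>f x\<bar> \<le> B"
  shows "integrable lborel (\<lambda>x. q x * f x)"
proof (rule Bochner_Integration.integrable_bound[of _ "\<lambda>x. B * q x"])
  note q = is_densityD[OF assms(1)]
  note [measurable] = q(5) borel_measurable_continuous_onI[OF assms(2)]
  show "integrable lborel (\<lambda>x. B * q x)" using q(3) by simp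
  show "(\<lambda>x. q x * f x) \<in> borel_measurable lborel" by measurable
  have "\<bar>q x * f x\<bar> \<le> \<bar>B * q x\<bar>" for x
  proof -
    have "\<bar>f x\<bar> * q x \<le> B * q x" using assms(3) q(2)[of x] by (intro mult_right_mono) auto
    then show ?thesis using q(2)[of x] by (simp add: abs_mult mult.commute)
  qed
  then show "AE x in lborel. norm (q x * f x) \<le> norm (B * q x)" by simp
qed

text \<open>The potential is half the squared norm plus \<open>e\<close> times \<open>Phi\<close>.
  The error bound is explicit, with constants independent of \<open>e\<close>, because the pointwise
  estimate is uniform and \<open>q\<close> integrates to 1.\<close>

lemma perturbed_identity_admissible:
  fixes q Phi :: "real^'n::finite \<Rightarrow> real"
  assumes q: "is_density q" and Phi: "smooth Phi" and K: "\<And>x v. norm (hess Phi x *v v) \<le> K * norm v" "K > 0"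
    and e: "\<bar>e\<bar> * K \<le> 1 / 2" and p: "is_density p" and push: "pushes (\<lambda>x. x + e *\<^sub>R grad Phi x) q p"
  shows "admissible p q"
    and "\<bar>D_TKL p q - e\<^sup>2 / 2 * (LINT x|lborel. trace (hess Phi x ** hess Phi x) * q x)\<bar>
      \<le> 2 * real CARD('n) * K ^ 3 * \<bar>e\<bar> ^ 3"
proof -
  note qd = is_densityD[OF q]
  let ?n = "real CARD('n)"
  define Q where "Q = (\<lambda>x :: real^'n. \<Sum>i\<in>UNIV. (1/2) * (x $ i * x $ i) + (0 :: real^'n) $ i * x $ i)"
  note Qp = quadratic_potential[of "0 :: real^'n", folded Q_def]
  define Psi where "Psi = (\<lambda>x. Q x + e * Phi x)"
  have ePhi: "smooth (\<lambda>x. e * Phi x)" by (intro smooth_mult smooth_const Phi)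
  have sm: "smooth Psi" unfolding Psi_def by (intro smooth_add Qp ePhi)
  have grad: "grad Psi = (\<lambda>x. x + e *\<^sub>R grad Phi x)"
    by (rule ext) (simp add: Psi_def grad_add[OF Qp(1) ePhi] Qp(2) grad_scale[OF Phi])
  have hess: "hess Psi x = mat 1 + e *\<^sub>R hess Phi x" for x
    by (simp add: Psi_def hess_add[OF Qp(1) ePhi] Qp(3) hess_scale[OF Phi])
  note pert = symmetric_perturbation[OF transpose_hess[OF Phi] K(1) e, folded hess]
  have lip: "norm (e *\<^sub>R grad Phi x - e *\<^sub>R grad Phi y) \<le> 1 / 2 * norm (x - y)" for x y
  proof -
    have "onorm ((*v) (hess Phi z)) \<le> K" for z by (rule onorm_le) (rule K)
    then have "norm (grad Phi x - grad Phi y) \<le> K * norm (x - y)"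
      by (intro differentiable_bound[of UNIV "grad Phi" "\<lambda>z. (*v) (hess Phi z)"])
        (auto intro: grad_has_derivative Phi)
    then have "\<bar>e\<bar> * norm (grad Phi x - grad Phi y) \<le> \<bar>e\<bar> * (K * norm (x - y))" by (rule mult_left_mono) simp
    also have "\<dots> = (\<bar>e\<bar> * K) * norm (x - y)" by simp
    also have "\<dots> \<le> 1 / 2 * norm (x - y)" using e by (rule mult_right_mono) simp
    finally show ?thesis by (simp add: scaleR_diff_right[symmetric])
  qed
  have "\<exists>!x. grad Psi x = y" for y
  proof -
    \<comment> \<open>Solving \<open>grad Psi x = y\<close> amounts to finding a fixed point of this
      map, a contraction by \<open>lip\<close>.\<close>
    have "\<exists>!x. y - e *\<^sub>R grad Phi x = x"
    proof (rule banach_fix_type[of "1/2"], safe)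
      fix x x' show "dist (y - e *\<^sub>R grad Phi x) (y - e *\<^sub>R grad Phi x') \<le> 1 / 2 * dist x x'"
        using lip[of x x'] by (simp add: dist_norm norm_minus_commute)
    qed auto
    moreover have "y - e *\<^sub>R grad Phi x = x \<longleftrightarrow> grad Psi x = y" for x
      by (auto simp: grad algebra_simps)
    ultimately show ?thesis by simp
  qed
  then have bij: "bij (grad Psi)" by (metis bij_iff)
  define G where "G = inv (grad Psi)"
  have GF: "G (grad Psi x) = x" and FG: "grad Psi (G y) = y" for x y
    using bij by (simp_all add: G_def bij_is_surj surj_f_inv_f bij_is_inj)
  \<comment> \<open>The constant is \<open>1 / (1 - 1 / 2)\<close>: half of the distance is absorbed
    into the left-hand side. Continuity of the inverse is the input for its smoothness.\<close>
  have "dist (G y) (G y') \<le> 2 * dist y y'" for y y'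
  proof -
    have eq: "G y - G y' = (y - y') - (e *\<^sub>R grad Phi (G y) - e *\<^sub>R grad Phi (G y'))"
      using FG[of y] FG[of y'] by (simp add: grad algebra_simps)
    have "norm (G y - G y') \<le> norm (y - y') + norm (e *\<^sub>R grad Phi (G y) - e *\<^sub>R grad Phi (G y'))"
      by (subst eq) (rule norm_triangle_ineq4)
    with lip[of "G y" "G y'"] have "norm (G y - G y') \<le> 2 * norm (y - y')" by linarith
    then show ?thesis by (simp add: dist_norm)
  qed
  then have "2-lipschitz_on UNIV G" by (intro lipschitz_onI) auto
  then have contG: "continuous_on UNIV G" by (rule lipschitz_on_continuous_on)
  note inv = inverse_grad_smooth[OF sm pert(1) GF FG contG]
  have smg: "smooth_map (grad Psi)"
    by (simp add: smooth_map_def grad_def smooth_partial sm)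
  have diffeo: "diffeo (grad Psi)" using bij smg inv(3) by (simp add: diffeo_def G_def)
  have contdet: "continuous_on UNIV (\<lambda>x. det (hess Psi x))"
    by (intro smooth_imp_continuous_on smooth_det hess_component_smooth sm)
  have push': "pushes (grad Psi) q p" using push by (simp add: grad)
  have jac: "p (grad Psi x) * det (hess Psi x) = q x" for x
    by (rule pushes_imp_jacobian_equation[OF grad_has_derivative[OF sm] inv(1) GF FG inv(2)
          transpose_hess[OF sm] contdet posdef_det_pos[OF pert(1)] p q push'])
  let ?H = "hess Phi"
  have lap: "lap Psi x = ?n + e * trace (?H x)" for x
    by (simp add: lap_def hess trace_add trace_scaleR trace_I)
  have contlnd: "continuous_on UNIV (\<lambda>x. ln (det (hess Psi x)))"
    by (rule continuous_ln_det_hess[OF sm pert(1)])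
  have e1: "\<bar>e * trace (?H x)\<bar> \<le> \<bar>e\<bar> * (?n * K)" for x
    unfolding abs_mult by (intro mult_left_mono pert) auto
  have int_lap: "integrable lborel (\<lambda>x. q x * lap Psi x)"
    using e1 by (intro integrable_density_mult_bounded[OF q, of _ "?n + \<bar>e\<bar> * (?n * K)"] smooth_imp_continuous_on smooth_lap sm)
      (auto simp: lap intro: order_trans[OF abs_triangle_ineq])
  have e2: "\<bar>e\<^sup>2 / 2 * trace (?H x ** ?H x)\<bar> \<le> e\<^sup>2 / 2 * (?n * K\<^sup>2)" for x
    unfolding abs_mult using mult_left_mono[OF pert(3)[of x], of "e\<^sup>2 / 2"] by simp
  have int_ln: "integrable lborel (\<lambda>x. q x * ln (det (hess Psi x)))"
  proof (rule integrable_density_mult_bounded[OF q contlnd])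
    fix x
    \<comment> \<open>The three terms bound the linear part, the quadratic part and the remainder of
      the expansion of \<open>ln \<circ> det\<close>.\<close>
    show "\<bar>ln (det (hess Psi x))\<bar> \<le> \<bar>e\<bar> * (?n * K) + e\<^sup>2 / 2 * (?n * K\<^sup>2) + 2 * ?n * K ^ 3 * \<bar>e\<bar> ^ 3"
      using pert(2)[of x] e1[of x] e2[of x] by linarith
  qed
  have nonneg: "v \<bullet> (hess Psi x *v v) \<ge> 0" for x v
    using pert(1)[of x] by (cases "v = 0") (auto simp: posdef_def less_imp_le)
  have pot: "admissible_pot p q Psi"
    unfolding admissible_pot_def brenier_potential_def
    using convex_on_UNIV_if_hess[OF sm nonneg] push' sm pert(1) diffeo jac int_lap int_ln by (auto simp: posdef_def)
  then show "admissible p q" using p q by (auto simp: admissible_def)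
  have conttr: "continuous_on UNIV (\<lambda>x. trace (?H x ** ?H x))"
    unfolding trace_def matrix_matrix_mult_def
    by (simp, intro continuous_intros smooth_imp_continuous_on hess_component_smooth Phi)
  have int_tr: "integrable lborel (\<lambda>x. trace (?H x ** ?H x) * q x)"
    using integrable_density_mult_bounded[OF q conttr pert(3)] by (simp add: mult.commute)
  \<comment> \<open>The constant \<open>?n\<close> in the integrand cancels against the Laplacian of
    the quadratic part, leaving exactly the remainder bounded in \<open>pert\<close>.\<close>
  let ?R = "\<lambda>x. e * trace (?H x) - ln (det (hess Psi x)) - e\<^sup>2 / 2 * trace (?H x ** ?H x)"
  have D: "D_TKL p q = (LINT x|lborel. (lap Psi x - ln (det (hess Psi x)) - ?n) * q x)"
    by (rule D_TKL_admissible_pot[OF q pot])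
  have "D_TKL p q - e\<^sup>2 / 2 * (LINT x|lborel. trace (?H x ** ?H x) * q x)
      = (LINT x|lborel. (lap Psi x - ln (det (hess Psi x)) - ?n) * q x) - (LINT x|lborel. e\<^sup>2 / 2 * (trace (?H x ** ?H x) * q x))"
    unfolding D by simp
  also have "\<dots> = (LINT x|lborel. (lap Psi x - ln (det (hess Psi x)) - ?n) * q x - e\<^sup>2 / 2 * (trace (?H x ** ?H x) * q x))"
    by (rule Bochner_Integration.integral_diff[symmetric]) (intro integrable_D_TKL[OF q pot] integrable_mult_right int_tr)+
  also have "\<dots> = (LINT x|lborel. ?R x * q x)"
    by (intro Bochner_Integration.integral_cong refl, unfold lap) (simp add: algebra_simps)
  also have "\<bar>\<dots>\<bar> \<le> (LINT x|lborel. (2 * ?n * K ^ 3 * \<bar>e\<bar> ^ 3) * q x)"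
  proof (rule order_trans[OF integral_abs_bound], rule integral_mono)
    have "integrable lborel (\<lambda>x. (lap Psi x - ln (det (hess Psi x)) - ?n) * q x - e\<^sup>2 / 2 * (trace (?H x ** ?H x) * q x))"
      by (intro Bochner_Integration.integrable_diff integrable_D_TKL[OF q pot] integrable_mult_right int_tr)
    moreover have "(\<lambda>x. (lap Psi x - ln (det (hess Psi x)) - ?n) * q x - e\<^sup>2 / 2 * (trace (?H x ** ?H x) * q x)) = (\<lambda>x. ?R x * q x)"
      by (intro ext, unfold lap) (simp add: algebra_simps)
    ultimately show "integrable lborel (\<lambda>x. \<bar>?R x * q x\<bar>)" by simp
    show "integrable lborel (\<lambda>x. (2 * ?n * K ^ 3 * \<bar>e\<bar> ^ 3) * q x)" using qd(3) by simp
    fix x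
    show "\<bar>?R x * q x\<bar> \<le> (2 * ?n * K ^ 3 * \<bar>e\<bar> ^ 3) * q x"
      unfolding abs_mult abs_of_pos[OF qd(2)] using pert(2)[of x] qd(2)[of x] by (intro mult_right_mono) auto
  qed
  also have "\<dots> = 2 * ?n * K ^ 3 * \<bar>e\<bar> ^ 3" by (simp add: qd(4))
  finally show "\<bar>D_TKL p q - e\<^sup>2 / 2 * (LINT x|lborel. trace (?H x ** ?H x) * q x)\<bar> \<le> 2 * ?n * K ^ 3 * \<bar>e\<bar> ^ 3" .
qed

subsection \<open>The Hessian metric\<close>

text \<open>Admissibility near 0 is a conclusion and not an assumption, so the expansion concerns
  genuine transport divergences.\<close>

theorem D_TKL_hessian_metric:
  fixes q Phi :: "real^'n::finite \<Rightarrow> real"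
  assumes q: "is_density q" and Phi: "smooth Phi" "bounded {x. Phi x \<noteq> 0}"
    and qe: "\<forall>\<^sub>F e in nhds 0. is_density (qe e) \<and> pushes (\<lambda>x. x + e *\<^sub>R grad Phi x) q (qe e)"
  shows "\<forall>\<^sub>F e in at 0. admissible (qe e) q"
    and "(\<lambda>e. D_TKL (qe e) q - e\<^sup>2 / 2 * (LINT x|lborel. trace (hess Phi x ** hess Phi x) * q x)) \<in> o[at 0](\<lambda>e. e\<^sup>2)"
proof -
  obtain K where K: "K > 0" "\<And>x v. norm (hess Phi x *v v) \<le> K * norm v"
    using compact_support_hess_bounded[OF Phi] by blast
  have ev: "\<forall>\<^sub>F e in at 0. is_density (qe e) \<and> pushes (\<lambda>x. x + e *\<^sub>R grad Phi x) q (qe e)"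
    using qe unfolding eventually_at_filter by (rule eventually_mono) simp
  have near: "\<forall>\<^sub>F e :: real in at 0. \<bar>e\<bar> < r" if "r > 0" for r
    using that by (auto simp: eventually_at dist_real_def)
  have small: "\<forall>\<^sub>F e :: real in at 0. \<bar>e\<bar> * K \<le> 1 / 2"
    using near[of "1 / (2 * K)"] K(1) by (auto elim!: eventually_mono simp: field_simps)
  show "\<forall>\<^sub>F e in at 0. admissible (qe e) q"
    using ev small by eventually_elim (use perturbed_identity_admissible(1)[OF q Phi(1) K(2,1)] in blast)
  define c where "c = 2 * real CARD('n) * K ^ 3"
  have c: "c > 0" using K(1) by (simp add: c_def)
  have bound: "\<forall>\<^sub>F e in at 0. \<bar>D_TKL (qe e) q - e\<^sup>2 / 2 * (LINT x|lborel. trace (hess Phi x ** hess Phi x) * q x)\<bar> \<le> c * \<bar>e\<bar> ^ 3"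
    unfolding c_def
    using ev small by eventually_elim (use perturbed_identity_admissible(2)[OF q Phi(1) K(2,1)] in blast)
  show "(\<lambda>e. D_TKL (qe e) q - e\<^sup>2 / 2 * (LINT x|lborel. trace (hess Phi x ** hess Phi x) * q x)) \<in> o[at 0](\<lambda>e. e\<^sup>2)"
  proof (rule landau_o.smallI)
    fix s :: real assume s: "s > 0"
    \<comment> \<open>For \<open>\<bar>e\<bar> < s / c\<close> one factor of the cubic bound
      \<open>c * \<bar>e\<bar> ^ 3\<close> is absorbed into \<open>s\<close>.\<close>
    show "\<forall>\<^sub>F e in at 0. norm (D_TKL (qe e) q - e\<^sup>2 / 2 * (LINT x|lborel. trace (hess Phi x ** hess Phi x) * q x)) \<le> s * norm (e\<^sup>2)"
      using bound near[OF divide_pos_pos[OF s c]]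
    proof eventually_elim
      case (elim e)
      have "c * \<bar>e\<bar> \<le> s" using elim(2) c by (simp add: field_simps)
      then have "(c * \<bar>e\<bar>) * \<bar>e\<bar>\<^sup>2 \<le> s * \<bar>e\<bar>\<^sup>2" by (rule mult_right_mono) simp
      then show ?case using elim(1) by (simp add: power3_eq_cube power2_eq_square mult_ac)
    qed
  qed
qed

theorem mainTheorem9:
  shows
   "(\<forall>(p :: real^'n::finite \<Rightarrow> real) q. admissible p q \<longrightarrow>
        D_TKL p q \<ge> 0 \<and> (D_TKL p q = 0 \<longleftrightarrow> (\<exists>c. \<forall>x. p (x + c) = q x)))
    \<and>
    (\<forall>(p1 :: real^'n \<Rightarrow> real) q1 (p2 :: real^'m::finite \<Rightarrow> real) q2
       (p :: real^('n + 'm) \<Rightarrow> real) q.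
       admissible p1 q1 \<longrightarrow> admissible p2 q2 \<longrightarrow>
       (\<forall>x y. p (join x y) = p1 x * p2 y) \<longrightarrow> (\<forall>x y. q (join x y) = q1 x * q2 y) \<longrightarrow>
       D_TKL p q = D_TKL p1 q1 + D_TKL p2 q2)
    \<and>
    (\<forall>(q :: real^'n \<Rightarrow> real) Phi (qe :: real \<Rightarrow> real^'n \<Rightarrow> real).
       is_density q \<longrightarrow> smooth Phi \<longrightarrow> bounded {x. Phi x \<noteq> 0} \<longrightarrow>
       (\<forall>\<^sub>F e in nhds 0. is_density (qe e) \<and>
           pushes (\<lambda>x. x + e *\<^sub>R grad Phi x) q (qe e)) \<longrightarrow>
       (\<forall>\<^sub>F e in at 0. admissible (qe e) q) \<and>
       (\<lambda>e. D_TKL (qe e) q -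
            e\<^sup>2 / 2 * (LINT x|lborel. trace (hess Phi x ** hess Phi x) * q x))
         \<in> o[at (0::real)](\<lambda>e. e\<^sup>2))
    \<and>
    (\<forall>(q :: real^'n \<Rightarrow> real) p1 p2 Phi1 Phi2 pl (l :: real).
       is_density q \<longrightarrow> admissible p1 q \<longrightarrow> admissible p2 q \<longrightarrow>
       admissible_pot p1 q Phi1 \<longrightarrow> admissible_pot p2 q Phi2 \<longrightarrow>
       l \<in> {0..1} \<longrightarrow>
       pushes (\<lambda>x. l *\<^sub>R grad Phi1 x + (1 - l) *\<^sub>R grad Phi2 x) q pl \<longrightarrow>
       admissible pl q \<longrightarrow>
       D_TKL pl q \<le> l * D_TKL p1 q + (1 - l) * D_TKL p2 q)"
  by (intro conjI allI impI)
    (erule D_TKL_nonneg, erule D_TKL_eq_0_iff, (rule D_TKL_join; blast),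
      (rule D_TKL_hessian_metric(1); assumption), (rule D_TKL_hessian_metric(2); assumption),
      (rule D_TKL_transport_convex; assumption))

end
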